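(* Let $G$ be a connected graph with $2h_G\le N_G$ and at least five edges. If $G$ is 2-vertex reducible, then $c_2(G)_q\equiv0\mod q$ for every prime power $q$.
   Context: Graphs are finite, possibly with multiple edges and self-loops. $N_G$ is the number of edges and $h_G$ the number of loops (first Betti number) of $G$. $G$ is called 2-vertex reducible if there is a pair of distinct vertices such that removing them (and their incident edges) causes the graph to disconnect. The graph polynomial is $\Psi_G=\sum_T\prod_{e\notin T}\alpha_e$, summed over spanning trees $T$ of $G$; $[\Psi_G]_q$ is the number of its zeros in $\mathbb{F}_q^{N_G}$. The invariant $c_2(G)_q\in\mathbb{Z}/q\mathbb{Z}$ is defined by $[\Psi_G]_q\equiv c_2(G)_q\,q^2\mod q^3$. *)

theory Defs
  imports
    "HOL-Library.FuncSet"
    "HOL-Library.Cardinality"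
    "HOL-Number_Theory.Number_Theory"
begin

text \<open>
  Undirected graphs with multiple edges and self-loops. Edges are abstract labels, and
  \<open>ends G e\<close> is the set of end points of \<open>e\<close>, which is a singleton if \<open>e\<close> is a self-loop.
\<close>

record ('v, 'e) multigraph =
  verts :: "'v set"
  edges :: "'e set"
  ends :: "'e \<Rightarrow> 'v set"

definition finite_multigraph :: "('v, 'e) multigraph \<Rightarrow> bool" where
  "finite_multigraph G \<longleftrightarrow> finite (verts G) \<and> finite (edges G) \<and>
     (\<forall>e\<in>edges G. ends G e \<subseteq> verts G \<and> (card (ends G e) = 1 \<or> card (ends G e) = 2))"

definition adjacency :: "('v, 'e) multigraph \<Rightarrow> ('v \<times> 'v) set" where
  "adjacency G = {(u, v). \<exists>e\<in>edges G. ends G e = {u, v}}"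

definition joined :: "('v, 'e) multigraph \<Rightarrow> ('v \<times> 'v) set" where
  "joined G = {(u, v). u \<in> verts G \<and> v \<in> verts G \<and> (u, v) \<in> (adjacency G)\<^sup>*}"

text \<open>
  The graph without vertices counts as connected here, so that deleting all vertices of a
  graph is not regarded as disconnecting it.
\<close>

definition connected_graph :: "('v, 'e) multigraph \<Rightarrow> bool" where
  "connected_graph G \<longleftrightarrow> (\<forall>u\<in>verts G. \<forall>v\<in>verts G. (u, v) \<in> joined G)"

text \<open>The first Betti number, via the Euler characteristic; \<open>verts G // joined G\<close> is the
  set of connected components.\<close>

definition loop_number :: "('v, 'e) multigraph \<Rightarrow> int" where
  "loop_number G =
     int (card (edges G)) - int (card (verts G)) + int (card (verts G // joined G))"

definition delete_vertices :: "('v, 'e) multigraph \<Rightarrow> 'v set \<Rightarrow> ('v, 'e) multigraph" where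
  "delete_vertices G S =
     G\<lparr>verts := verts G - S, edges := {e \<in> edges G. ends G e \<inter> S = {}}\<rparr>"

definition two_vertex_reducible :: "('v, 'e) multigraph \<Rightarrow> bool" where
  "two_vertex_reducible G \<longleftrightarrow>
     (\<exists>u\<in>verts G. \<exists>v\<in>verts G. u \<noteq> v \<and> \<not> connected_graph (delete_vertices G {u, v}))"

text \<open>
  A cycle is given by its vertices \<open>vs\<close> and edges \<open>es\<close> in cyclic order. A self-loop is a
  cycle of length 1, and two parallel edges form a cycle of length 2.
\<close>

definition cycle :: "('v, 'e) multigraph \<Rightarrow> 'v list \<Rightarrow> 'e list \<Rightarrow> bool" where
  "cycle G vs es \<longleftrightarrow> es \<noteq> [] \<and> length vs = length es \<and> distinct vs \<and> distinct es \<and>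
     set es \<subseteq> edges G \<and>
     (\<forall>i<length es. ends G (es ! i) = {vs ! i, vs ! (Suc i mod length es)})"

definition tree_graph :: "('v, 'e) multigraph \<Rightarrow> bool" where
  "tree_graph G \<longleftrightarrow> connected_graph G \<and> \<not> (\<exists>vs es. cycle G vs es)"

text \<open>A spanning tree is represented by its edge set; it contains all vertices of \<open>G\<close>.\<close>

definition spanning_trees :: "('v, 'e) multigraph \<Rightarrow> 'e set set" where
  "spanning_trees G = {T. T \<subseteq> edges G \<and> tree_graph (G\<lparr>edges := T\<rparr>)}"

definition graph_polynomial :: "('v, 'e) multigraph \<Rightarrow> ('e \<Rightarrow> 'f) \<Rightarrow> 'f :: comm_ring_1" where
  "graph_polynomial G \<alpha> = (\<Sum>T\<in>spanning_trees G. \<Prod>e\<in>edges G - T. \<alpha> e)"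

text \<open>
  The field with \<open>q\<close> elements is a type \<open>'f\<close> of class \<open>field\<close> and \<open>finite\<close> with
  \<open>CARD('f) = q\<close>. Points of the affine space over it are the extensional functions
  on the edges.
\<close>

definition point_count :: "'f::{field,finite} itself \<Rightarrow> ('v, 'e) multigraph \<Rightarrow> nat" where
  "point_count _ G = card {\<alpha> \<in> edges G \<rightarrow>\<^sub>E (UNIV :: 'f set). graph_polynomial G \<alpha> = 0}"

text \<open>
  The residue class \<open>c\<^sub>2(G)\<^sub>q\<close> is given by its representative in \<open>{0..<q}\<close>. If the point count
  is not divisible by \<open>q\<^sup>2\<close>, then there is no such class and \<open>c2\<close> is unspecified.
\<close>

definition c2 :: "'f::{field,finite} itself \<Rightarrow> ('v, 'e) multigraph \<Rightarrow> nat" where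
  "c2 F G = (THE c. c < CARD('f) \<and> [point_count F G = c * CARD('f)^2] (mod CARD('f)^3))"

lemma c2_eqI:
  fixes F :: "'f::{field,finite} itself"
  assumes "c < CARD('f)" and "[point_count F G = c * CARD('f)^2] (mod CARD('f)^3)"
  shows "c2 F G = c"
  unfolding c2_def
proof (rule the_equality)
  fix d assume d: "d < CARD('f) \<and> [point_count F G = d * CARD('f)^2] (mod CARD('f)^3)"
  let ?q = "CARD('f)"
  have "d * ?q^2 mod ?q^3 = c * ?q^2 mod ?q^3"
    using d assms by (simp add: cong_def)
  moreover have "x * ?q^2 < ?q^3" if "x < ?q" for x
    using that by (simp add: power2_eq_square power3_eq_cube)
  ultimately show "d = c"
    using d assms by simp
qed (use assms in simp)

end

theory Submission
  imports
    Defs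
    "HOL-Computational_Algebra.Polynomial"
    "HOL-Library.Nat_Bijection"
begin

text \<open>
  The graph polynomial is studied through spanning forests with prescribed roots: for a set
  \<open>R\<close> of vertices let \<open>\<Psi>\<^sub>R\<close> be the sum of \<open>\<Prod>e\<in>E - F. \<alpha> e\<close> over the edge sets \<open>F\<close> of
  forests in which every tree contains exactly one vertex of \<open>R\<close>. The graph polynomial is
  \<open>\<Psi>\<close> with a single root. If \<open>e\<close> joins a root \<open>a\<close> to a vertex \<open>b\<close> that is not a root, then
  \<open>\<Psi>\<^sub>R(E) = \<alpha> e * \<Psi>\<^sub>R(E - e) + \<Psi>\<^sub>R\<^sub>b(E - e)\<close>, where \<open>Rb\<close> is \<open>R\<close> with \<open>b\<close> added. Contraction of
  an edge has become the addition of a root, so the vertex set never changes, and nearly every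
  statement below is an induction along such edges.

  Suppose that \<open>u\<close> and \<open>v\<close> separate \<open>G\<close> into two sides. Then \<open>\<Psi> = \<Psi>\<^sub>1 \<Phi>\<^sub>2 + \<Phi>\<^sub>1 \<Psi>\<^sub>2\<close>, where \<open>\<Psi>\<^sub>i\<close>
  has the root \<open>u\<close> and \<open>\<Phi>\<^sub>i\<close> has the roots \<open>u\<close> and \<open>v\<close> on side \<open>i\<close> (\<open>forests_glue_two\<close>). Both
  are homogeneous and their degrees differ by one, so scaling the variables shows that the
  number of points with \<open>\<Psi>\<^sub>1 + c \<Phi>\<^sub>1 \<noteq> 0\<close> is the same for all \<open>c \<noteq> 0\<close>. Therefore the number of
  points with \<open>\<Psi> \<noteq> 0\<close> is an explicit expression in the numbers \<open>p\<^sub>i\<close> of points with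
  \<open>\<Psi>\<^sub>i \<noteq> 0\<close>, \<open>m\<^sub>i\<close> with \<open>\<Phi>\<^sub>i \<noteq> 0\<close>, and \<open>n\<^sub>i\<close> with \<open>\<Psi>\<^sub>i\<close> and \<open>\<Phi>\<^sub>i\<close> not both zero, and it is
  divisible by \<open>q\<^sup>3\<close> once \<open>q\<^sup>2\<close> divides \<open>p\<^sub>i\<close> and \<open>q\<close> divides \<open>m\<^sub>i\<close> and \<open>n\<^sub>i\<close>
  (\<open>bilinear_nonzero_count\<close>). With at least three edges, \<open>q\<^sup>3\<close> also divides the number of all
  points, hence the number of zeros, which means \<open>c\<^sub>2 = 0\<close>.

  It remains to prove the three divisibilities. That \<open>q\<close> divides \<open>m\<^sub>i\<close> is an elementary case of
  the theorem of Warning and Ax: a polynomial of degree at most one in every variable that lacks the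
  monomial of all variables has a number of nonzeros divisible by \<open>q\<close> (\<open>warning_multilinear\<close>).
  For \<open>n\<^sub>i\<close>, elimination of one variable from the two equations leaves their resultant, which
  has degree two in the other variables and is not accessible to that argument. It is, however,
  minus the square of a forest polynomial of degree at most one in every variable, by the Dodgson
  identity (\<open>dodgson_forests\<close>), and the elementary case applies to that polynomial
  (\<open>two_roots_nonzero_count\<close>). One more elimination of a variable gives \<open>p\<^sub>i\<close>
  (\<open>forests_nonzero_count_square\<close>).

  The Dodgson identity comes from electrical networks. The forests in which \<open>p\<close> belongs to the tree
  of the additional root \<open>v\<close> define a function of \<open>p\<close> that is, up to the factor \<open>\<Psi>\<^sub>R\<close>, the
  potential for a unit current entering at \<open>v\<close> and leaving at \<open>R\<close> (\<open>green_kirchhoff\<close>). The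
  identity compares two potentials for the same currents with the same boundary values, and these
  agree where the forest polynomial rooted at the boundary does not vanish
  (\<open>dodgson_conductance\<close>). A generic point, namely \<open>\<alpha> e\<close> plus distinct powers of an indeterminate
  \<open>t\<close>, has this property, and \<open>t = 0\<close> gives the identity at every point.
\<close>

section \<open>Spanning forests with prescribed roots\<close>

context
  fixes nd :: "'e \<Rightarrow> 'v set"
begin

definition link :: "'e set \<Rightarrow> ('v \<times> 'v) set" where
  "link F = {(a, b). \<exists>e\<in>F. nd e = {a, b}}"

definition edges_in :: "'v set \<Rightarrow> 'e set \<Rightarrow> bool" where
  "edges_in V E \<longleftrightarrow> finite V \<and> finite E \<and> (\<forall>e\<in>E. \<exists>a\<in>V. \<exists>b\<in>V. nd e = {a, b})"

definition spans :: "'v set \<Rightarrow> 'v set \<Rightarrow> 'e set \<Rightarrow> bool" where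
  "spans V R F \<longleftrightarrow> (\<forall>v\<in>V. \<exists>r\<in>R. (r, v) \<in> (link F)\<^sup>*)"

text \<open>
  The condition on the cardinality replaces acyclicity and the condition that distinct roots lie in
  distinct trees: an edge set of this size can reach all of \<open>V\<close> from \<open>R\<close> only if no edge is
  redundant. No path or cycle has to be mentioned.
\<close>

definition forests :: "'v set \<Rightarrow> 'e set \<Rightarrow> 'v set \<Rightarrow> 'e set set" where
  "forests V E R = {F. F \<subseteq> E \<and> card F = card (V - R) \<and> spans V R F}"

text \<open>
  The forests with roots \<open>R\<close> and \<open>v\<close> in which \<open>p\<close> lies in the tree of \<open>v\<close>. The family is empty
  by convention if \<open>v\<close> is in \<open>R\<close> already; with this convention the edge recursion
  \<open>linking_split\<close> holds also when the new root is \<open>v\<close>.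
\<close>

definition linking :: "'v set \<Rightarrow> 'e set \<Rightarrow> 'v set \<Rightarrow> 'v \<Rightarrow> 'v \<Rightarrow> 'e set set" where
  "linking V E R p v = {F \<in> forests V E (insert v R). v \<notin> R \<and> (p, v) \<in> (link F)\<^sup>*}"

lemma edges_in_mono: "edges_in V E \<Longrightarrow> F \<subseteq> E \<Longrightarrow> edges_in V F"
  unfolding edges_in_def by (meson finite_subset subset_iff)

lemma edges_in_ends: "edges_in V E \<Longrightarrow> e \<in> E \<Longrightarrow> nd e = {a, b} \<Longrightarrow> a \<in> V \<and> b \<in> V"
  unfolding edges_in_def by (metis empty_iff insert_iff)

lemma edges_in_subset: "edges_in V E \<Longrightarrow> e \<in> E \<Longrightarrow> nd e \<subseteq> V"
  unfolding edges_in_def by fastforce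

lemma edges_in_pair:
  "edges_in V E \<Longrightarrow> e \<in> E \<Longrightarrow> b \<in> nd e \<Longrightarrow> s \<in> nd e \<Longrightarrow> s \<noteq> b \<Longrightarrow> nd e = {b, s}"
  unfolding edges_in_def by fastforce

lemma linkI: "e \<in> F \<Longrightarrow> nd e = {a, b} \<Longrightarrow> (a, b) \<in> (link F)\<^sup>*"
  unfolding link_def by blast

lemma link_mono: "F \<subseteq> F' \<Longrightarrow> (a, b) \<in> (link F)\<^sup>* \<Longrightarrow> (a, b) \<in> (link F')\<^sup>*"
  by (rule rtrancl_mono[THEN subsetD]) (auto simp: link_def)

lemma link_sym: "(a, b) \<in> (link F)\<^sup>* \<Longrightarrow> (b, a) \<in> (link F)\<^sup>*"
proof -
  have "sym (link F)" unfolding link_def sym_def by (auto simp: insert_commute)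
  then show "(a, b) \<in> (link F)\<^sup>* \<Longrightarrow> (b, a) \<in> (link F)\<^sup>*"
    by (meson sym_rtrancl symD)
qed

lemma link_trans: "(a, b) \<in> (link F)\<^sup>* \<Longrightarrow> (b, c) \<in> (link F)\<^sup>* \<Longrightarrow> (a, c) \<in> (link F)\<^sup>*"
  by simp

text \<open>
  Follow the path from \<open>x\<close> to \<open>y\<close> after its last use of \<open>e\<close>.
\<close>

lemma link_cut:
  assumes "(x, y) \<in> (link F)\<^sup>*" and "nd e = {a, b}"
  shows "(x, y) \<in> (link (F - {e}))\<^sup>* \<or> (a, y) \<in> (link (F - {e}))\<^sup>* \<or> (b, y) \<in> (link (F - {e}))\<^sup>*"
  using assms(1)
proof (induction rule: rtrancl_induct)
  case base
  then show ?case by simp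
next
  case (step y z)
  from step.hyps(2) obtain e' where e': "e' \<in> F" "nd e' = {y, z}"
    unfolding link_def by auto
  show ?case
  proof (cases "e' = e")
    case True
    then have "z = a \<or> z = b" using e' assms(2) by auto
    then show ?thesis by auto
  next
    case False
    then have "(y, z) \<in> link (F - {e})" using e' unfolding link_def by auto
    then show ?thesis using step.IH by (meson rtrancl.rtrancl_into_rtrancl)
  qed
qed

text \<open>
  The edge by which the path leaves \<open>b\<close> for the last time; the rest of the path does not use any
  edge at \<open>b\<close>.
\<close>

lemma link_first_edge:
  assumes "(b, y) \<in> (link F)\<^sup>*" and "y \<noteq> b"
  shows "\<exists>e\<in>F. \<exists>s. nd e = {b, s} \<and> s \<noteq> b \<and> (s, y) \<in> (link (F - {e}))\<^sup>*"
proof -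
  have "y = b \<or> (\<exists>e\<in>F. \<exists>s. nd e = {b, s} \<and> s \<noteq> b \<and> (s, y) \<in> (link {e\<in>F. b \<notin> nd e})\<^sup>*)"
    using assms(1)
  proof (induction rule: rtrancl_induct)
    case base
    then show ?case by simp
  next
    case (step y z)
    from step.hyps(2) obtain e' where e': "e' \<in> F" "nd e' = {y, z}"
      unfolding link_def by auto
    show ?case
    proof (cases "y = b \<or> z = b")
      case True
      then show ?thesis using e' by blast
    next
      case False
      then have "(y, z) \<in> link {e\<in>F. b \<notin> nd e}" using e' unfolding link_def by auto
      then show ?thesis using step.IH False by (meson rtrancl.rtrancl_into_rtrancl)
    qed
  qed
  then obtain e s where es: "e \<in> F" "nd e = {b, s}" "s \<noteq> b"
    "(s, y) \<in> (link {e\<in>F. b \<notin> nd e})\<^sup>*" using assms(2) by blast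
  have "(s, y) \<in> (link (F - {e}))\<^sup>*"
    by (rule link_mono[OF _ es(4)]) (use es in auto)
  then show ?thesis using es by blast
qed

lemma crossing_edge:
  assumes "(x, y) \<in> (link F)\<^sup>*" and "x \<in> R" and "y \<notin> R"
  shows "\<exists>e\<in>F. \<exists>a\<in>R. \<exists>b. b \<notin> R \<and> nd e = {a, b}"
  using assms
proof (induction rule: rtrancl_induct)
  case (step y z)
  then show ?case unfolding link_def by blast
qed simp

text \<open>
  This equivalence replaces contraction: using the edge \<open>e\<close> from a root to \<open>b\<close> has the same
  effect as declaring \<open>b\<close> a root.
\<close>

lemma spans_insert_edge_iff:
  assumes "a \<in> R" and "nd e = {a, b}" and "e \<notin> F"
  shows "spans V R (insert e F) \<longleftrightarrow> spans V (insert b R) F"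
proof
  assume s: "spans V R (insert e F)"
  show "spans V (insert b R) F"
    unfolding spans_def
  proof
    fix v assume "v \<in> V"
    then obtain r where r: "r \<in> R" "(r, v) \<in> (link (insert e F))\<^sup>*"
      using s unfolding spans_def by blast
    from link_cut[OF r(2) assms(2)] show "\<exists>r\<in>insert b R. (r, v) \<in> (link F)\<^sup>*"
      using assms r(1) by auto
  qed
next
  assume s: "spans V (insert b R) F"
  have ab: "(a, b) \<in> (link (insert e F))\<^sup>*" using assms(2) by (intro linkI) auto
  show "spans V R (insert e F)"
    unfolding spans_def
  proof
    fix v assume "v \<in> V"
    then obtain r where r: "r \<in> insert b R" "(r, v) \<in> (link F)\<^sup>*"
      using s unfolding spans_def by blast
    have "(r, v) \<in> (link (insert e F))\<^sup>*" using r(2) link_mono by blast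
    then show "\<exists>r\<in>R. (r, v) \<in> (link (insert e F))\<^sup>*"
      using r(1) ab assms(1) by (metis insert_iff link_trans)
  qed
qed

lemma boundary_edge_exists:
  assumes "spans V R F" and "\<not> V \<subseteq> R" and "edges_in V F"
  obtains e a b where "e \<in> F" "a \<in> R" "b \<in> V - R" "nd e = {a, b}"
proof -
  obtain v where v: "v \<in> V" "v \<notin> R" using assms(2) by blast
  then obtain r where r: "r \<in> R" "(r, v) \<in> (link F)\<^sup>*"
    using assms(1) unfolding spans_def by blast
  from crossing_edge[OF r(2) r(1) v(2)] obtain e a b where
    "e \<in> F" "a \<in> R" "b \<notin> R" "nd e = {a, b}" by blast
  moreover have "b \<in> V" using \<open>e \<in> F\<close> assms(3) \<open>nd e = {a, b}\<close> edges_in_ends by blast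
  ultimately show ?thesis using that by blast
qed

text \<open>
  Grow the roots along boundary edges, one vertex and one edge at a time.
\<close>

lemma forest_exists:
  assumes "edges_in V F" and "spans V R F"
  shows "forests V F R \<noteq> {}"
  using assms
proof (induction "card F" arbitrary: F R rule: less_induct)
  case less
  show ?case
  proof (cases "V \<subseteq> R")
    case True
    then have "V - R = {}" by blast
    then have "card {} = card (V - R)" by (metis card.empty)
    moreover have "spans V R {}" using True unfolding spans_def by blast
    ultimately show ?thesis unfolding forests_def by blast
  next
    case False
    obtain e a b where e: "e \<in> F" "a \<in> R" "b \<in> V - R" "nd e = {a, b}"
      using boundary_edge_exists[OF less.prems(2) False less.prems(1)] .
    have fin: "finite F" "finite V" using less.prems unfolding edges_in_def by auto
    have "spans V (insert b R) (F - {e})"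
      using spans_insert_edge_iff[OF e(2,4), of "F - {e}" V] less.prems(2) e(1)
      by (simp add: insert_absorb)
    moreover have "card (F - {e}) < card F" using fin e(1) by (intro card_Diff1_less)
    ultimately obtain F0 where F0: "F0 \<in> forests V (F - {e}) (insert b R)"
      using less.hyps[of "F - {e}" "insert b R"] edges_in_mono[OF less.prems(1)] by blast
    have "finite F0" using F0 fin finite_subset unfolding forests_def by fastforce
    moreover have "e \<notin> F0" using F0 unfolding forests_def by auto
    moreover have "card (V - R) = Suc (card (V - insert b R))"
      using e(3) fin by (metis card_Suc_Diff1 finite_Diff Diff_insert)
    ultimately have "insert e F0 \<in> forests V F R"
      using F0 e spans_insert_edge_iff[OF e(2,4), of F0 V] unfolding forests_def by auto
    then show ?thesis by blast
  qed
qed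

lemma spans_card_le:
  assumes "edges_in V F" and "spans V R F"
  shows "card (V - R) \<le> card F"
proof -
  obtain F0 where "F0 \<subseteq> F" "card F0 = card (V - R)"
    using forest_exists[OF assms] unfolding forests_def by blast
  then show ?thesis using assms(1) card_mono unfolding edges_in_def by metis
qed

text \<open>
  If two roots were linked, one of them could be dropped from the roots, and then \<open>F\<close> would have
  fewer edges than any spanning set needs.
\<close>

lemma forest_separates_roots:
  assumes "edges_in V E" and "R \<subseteq> V" and "F \<in> forests V E R"
    and "r \<in> R" and "r' \<in> R" and "(r, r') \<in> (link F)\<^sup>*"
  shows "r = r'"
proof (rule ccontr)
  assume ne: "r \<noteq> r'"
  have fin: "finite V" using assms(1) unfolding edges_in_def by simp
  have "spans V (R - {r'}) F"
    using assms(3-6) ne unfolding forests_def spans_def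
    by (clarsimp) (metis Diff_iff empty_iff insert_iff link_trans)
  moreover have "edges_in V F" using assms(1,3) edges_in_mono unfolding forests_def by blast
  ultimately have "card (V - (R - {r'})) \<le> card F" by (rule spans_card_le[rotated])
  moreover have "V - (R - {r'}) = insert r' (V - R)" using assms(2,5) by auto
  ultimately show False using assms(3,5) fin unfolding forests_def by simp
qed

text \<open>
  The basic recursion, according to whether the edge \<open>e\<close> from a root to a new vertex is used.
\<close>

lemma forests_split:
  assumes "edges_in V E" and "e \<in> E" and "nd e = {a, b}" and "a \<in> R" and "b \<notin> R"
  shows "forests V E R = forests V (E - {e}) R \<union> insert e ` forests V (E - {e}) (insert b R)"
    (is "?L = ?A \<union> ?B")
proof -
  have fin: "finite V" "finite E" using assms(1) unfolding edges_in_def by auto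
  have bV: "b \<in> V" using edges_in_ends assms(1-3) by blast
  have card: "card (V - R) = Suc (card (V - insert b R))"
    using assms(5) bV fin by (metis card_Suc_Diff1 finite_Diff Diff_insert DiffI)
  have *: "F \<in> ?L \<longleftrightarrow> F - {e} \<in> forests V (E - {e}) (insert b R)" if "e \<in> F" for F
  proof -
    have "F - {e} \<subseteq> E - {e} \<longleftrightarrow> F \<subseteq> E" using that assms(2) by blast
    moreover have "card F = Suc (card (F - {e}))" if "F \<subseteq> E"
      using that \<open>e \<in> F\<close> fin by (metis card.remove rev_finite_subset)
    ultimately show ?thesis
      using card that spans_insert_edge_iff[OF assms(4,3), of "F - {e}" V]
      unfolding forests_def by (auto simp: insert_absorb)
  qed
  show ?thesis
  proof (intro equalityI subsetI)
    fix F assume F: "F \<in> ?L"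
    show "F \<in> ?A \<union> ?B"
    proof (cases "e \<in> F")
      case True
      then have "F = insert e (F - {e})" by blast
      then show ?thesis using * F True by blast
    next
      case False
      then show ?thesis using F unfolding forests_def by auto
    qed
  next
    fix F assume "F \<in> ?A \<union> ?B"
    then show "F \<in> ?L"
    proof
      assume "F \<in> ?A" then show ?thesis unfolding forests_def by auto
    next
      assume "F \<in> ?B"
      then obtain F' where F': "F = insert e F'" "F' \<in> forests V (E - {e}) (insert b R)" by blast
      then have "F - {e} = F'" unfolding forests_def by auto
      then show ?thesis using * F' by auto
    qed
  qed
qed

lemma forests_Pow: "forests V E R \<subseteq> Pow E"
  unfolding forests_def by auto

lemma linking_Pow: "linking V E R p v \<subseteq> Pow E"
  unfolding linking_def forests_def by auto

lemma forests_all: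
  assumes "V \<subseteq> R" and "finite E"
  shows "forests V E R = {{}}"
proof -
  have "V - R = {}" using assms(1) by blast
  then have c: "card (V - R) = 0" by (metis card.empty)
  have "spans V R F" for F using assms(1) unfolding spans_def by blast
  moreover have "card F = 0 \<longleftrightarrow> F = {}" if "F \<subseteq> E" for F
    using finite_subset[OF that assms(2)] by simp
  ultimately show ?thesis unfolding forests_def c by auto
qed

lemma forests_empty:
  assumes "edges_in V E" and "\<not> V \<subseteq> R"
    and "\<And>e a b. e \<in> E \<Longrightarrow> a \<in> R \<Longrightarrow> b \<in> V - R \<Longrightarrow> nd e \<noteq> {a, b}"
  shows "forests V E R = {}"
proof (rule ccontr)
  assume "forests V E R \<noteq> {}"
  then obtain F where F: "F \<subseteq> E" "spans V R F" unfolding forests_def by blast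
  obtain e a b where "e \<in> F" "a \<in> R" "b \<in> V - R" "nd e = {a, b}"
    using boundary_edge_exists[OF F(2) assms(2) edges_in_mono[OF assms(1) F(1)]] .
  then show False using assms(3)[of e a b] F(1) by (simp add: subset_iff)
qed

lemma linking_empty_root:
  assumes "edges_in V E" and "R \<subseteq> V" and "v \<in> V" and "p \<in> R"
  shows "linking V E R p v = {}"
proof (rule ccontr)
  assume "linking V E R p v \<noteq> {}"
  then obtain F where F: "F \<in> forests V E (insert v R)" "v \<notin> R" "(p, v) \<in> (link F)\<^sup>*"
    unfolding linking_def by blast
  have "p = v" by (rule forest_separates_roots[OF assms(1) _ F(1) _ _ F(3)]) (use assms in auto)
  then show False using F(2) assms(4) by blast
qed

lemma linking_self: "v \<notin> R \<Longrightarrow> linking V E R v v = forests V E (insert v R)"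
  unfolding linking_def by auto

lemma linking_commute_aux:
  assumes "finite V" "p \<in> V - R" and "v \<in> V - R" and "F \<in> linking V E R p v"
  shows "F \<in> linking V E R v p"
proof -
  have F: "F \<subseteq> E" "card F = card (V - insert v R)" "spans V (insert v R) F" "(p, v) \<in> (link F)\<^sup>*"
    using assms(4) unfolding linking_def forests_def by auto
  have "card (V - insert v R) = card (V - insert p R)"
    using assms(1-3) by (metis card_Diff_singleton Diff_insert finite_Diff)
  moreover have "spans V (insert p R) F"
    using F(3,4) unfolding spans_def by (metis insert_iff link_trans)
  ultimately show ?thesis using F assms(2) link_sym unfolding linking_def forests_def by auto
qed

text \<open>
  A tree that contains both \<open>p\<close> and \<open>v\<close> may be rooted at either of them.
\<close>

lemma linking_commute:
  assumes "finite V" "p \<in> V - R" and "v \<in> V - R"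
  shows "linking V E R p v = linking V E R v p"
  using linking_commute_aux[OF assms] linking_commute_aux[OF assms(1,3,2)] by blast

text \<open>
  The new point compared to \<open>forests_split\<close> is that \<open>p\<close> and \<open>v\<close> are linked without \<open>e\<close>:
  otherwise the tree of \<open>v\<close> would contain \<open>a\<close> or \<open>b\<close>, which are roots of other trees.
\<close>

lemma linking_split:
  assumes "edges_in V E" and "R \<subseteq> V" and "v \<in> V"
    and "e \<in> E" and "nd e = {a, b}" and "a \<in> R" and "b \<notin> R"
  shows "linking V E R p v =
    linking V (E - {e}) R p v \<union> insert e ` linking V (E - {e}) (insert b R) p v"
    (is "?L = ?A \<union> ?B")
proof (intro equalityI subsetI)
  have bV: "b \<in> V" using edges_in_ends assms(1,4,5) by blast
  have Vb: "insert b (insert v R) \<subseteq> V" "insert v R \<subseteq> V" using bV assms by auto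
  have E': "edges_in V (E - {e})" using edges_in_mono[OF assms(1)] by blast
  fix F assume F: "F \<in> ?L"
  then have F1: "F \<in> forests V E (insert v R)" "v \<notin> R" "(p, v) \<in> (link F)\<^sup>*"
    unfolding linking_def by auto
  show "F \<in> ?A \<union> ?B"
  proof (cases "e \<in> F")
    case False
    then show ?thesis using F unfolding linking_def forests_def by auto
  next
    case True
    have "b \<noteq> v"
    proof
      assume "b = v"
      then have "a = v"
        using linkI[OF True assms(5)] forest_separates_roots[OF assms(1) Vb(2) F1(1), of a v]
          assms(6) by auto
      then show False using F1 assms(6) by blast
    qed
    then have bn: "b \<notin> insert v R" using assms(7) by blast
    have "F \<notin> forests V (E - {e}) (insert v R)" using True unfolding forests_def by blast
    then obtain F' where F': "F = insert e F'" "F' \<in> forests V (E - {e}) (insert b (insert v R))"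
      using forests_split[OF assms(1,4,5) insertI2[OF assms(6)] bn] F1(1) by blast
    have eF: "F - {e} = F'" using F' unfolding forests_def by auto
    have no: "(a, v) \<notin> (link F')\<^sup>*" "(b, v) \<notin> (link F')\<^sup>*"
      using forest_separates_roots[OF E' Vb(1) F'(2), of a v]
        forest_separates_roots[OF E' Vb(1) F'(2), of b v] assms(6) F1(2) \<open>b \<noteq> v\<close> by auto
    have "(p, v) \<in> (link F')\<^sup>*"
      using link_cut[OF F1(3) assms(5)] no unfolding eF by blast
    then have "F' \<in> linking V (E - {e}) (insert b R) p v"
      using F'(2) F1(2) \<open>b \<noteq> v\<close> unfolding linking_def by (simp add: insert_commute)
    then show ?thesis using F'(1) by blast
  qed
next
  fix F assume "F \<in> ?A \<union> ?B"
  then show "F \<in> ?L"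
  proof
    assume "F \<in> ?A" then show ?thesis unfolding linking_def forests_def by auto
  next
    assume "F \<in> ?B"
    then obtain F' where F': "F = insert e F'" "F' \<in> forests V (E - {e}) (insert v (insert b R))"
      "v \<notin> insert b R" "(p, v) \<in> (link F')\<^sup>*" unfolding linking_def by auto
    have "F \<in> forests V E (insert v R)"
    proof -
      have "b \<notin> insert v R" "a \<in> insert v R" using F'(3) assms(6,7) by auto
      from forests_split[OF assms(1,4,5) this(2,1)] show ?thesis
        using F'(1,2) by (simp add: insert_commute)
    qed
    moreover have "(p, v) \<in> (link F)\<^sup>*"
      by (rule link_mono[OF _ F'(4)]) (use F'(1) in blast)
    ultimately show ?thesis using F'(3) unfolding linking_def by simp
  qed
qed

text \<open>
  Cut the path from \<open>b\<close> to \<open>v\<close> at its first edge \<open>e\<close>: what remains is a forest with the additional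
  root \<open>b\<close> in which the other end \<open>s\<close> of \<open>e\<close> lies in the tree of \<open>v\<close>. The edge can be recovered,
  because in a forest only one edge at \<open>b\<close> leads towards \<open>v\<close>.
\<close>

lemma linking_first_edge_bij:
  assumes "edges_in V E" and "R \<subseteq> V" and "b \<in> V - R" and "v \<in> V - R" and "b \<noteq> v"
  shows "bij_betw (\<lambda>(e, s, F). insert e F)
    {(e, s, F). e \<in> E \<and> b \<in> nd e \<and> s \<in> nd e \<and> F \<in> linking V E (insert b R) s v}
    (linking V E R b v)" (is "bij_betw ?f ?D ?C")
proof -
  let ?R = "insert v (insert b R)"
  have RV: "?R \<subseteq> V" using assms by auto
  have fin: "finite V" "finite E" using assms(1) unfolding edges_in_def by auto
  have nob: "(b, v) \<notin> (link F)\<^sup>*" if "F \<in> forests V E ?R" for F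
    using forest_separates_roots[OF assms(1) RV that, of b v] assms(5) by auto
  have D: "nd e = {b, s} \<and> s \<noteq> b \<and> e \<notin> F \<and> F \<in> forests V E ?R \<and> e \<in> E \<and>
      (s, v) \<in> (link F)\<^sup>* \<and> (b, v) \<notin> (link F)\<^sup>*" if "(e, s, F) \<in> ?D" for e s F
  proof -
    from that have F: "F \<in> forests V E ?R" "(s, v) \<in> (link F)\<^sup>*" and e: "e \<in> E" "b \<in> nd e" "s \<in> nd e"
      unfolding linking_def by auto
    have sb: "s \<noteq> b" using F nob by blast
    then have nd: "nd e = {b, s}" using edges_in_pair[OF assms(1) e sb] by simp
    have "e \<notin> F" using linkI[of e F b s] nd nob[OF F(1)] F(2) link_trans by blast
    then show ?thesis using sb nd F e nob by blast
  qed
  have img: "?f x \<in> ?C" if "x \<in> ?D" for x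
  proof -
    obtain e s F where x: "x = (e, s, F)" by (metis prod_cases3)
    note d = D[OF that[unfolded x]]
    have "(b, s) \<in> (link (insert e F))\<^sup>*" using d by (intro linkI) auto
    moreover have sv: "(s, v) \<in> (link (insert e F))\<^sup>*" using d link_mono by blast
    ultimately have bv: "(b, v) \<in> (link (insert e F))\<^sup>*" by (rule link_trans)
    have "spans V (insert v R) (insert e F)"
      unfolding spans_def
    proof
      fix y assume "y \<in> V"
      then obtain r where r: "r \<in> ?R" "(r, y) \<in> (link F)\<^sup>*"
        using d unfolding forests_def spans_def by blast
      then have "(r, y) \<in> (link (insert e F))\<^sup>*" using link_mono by blast
      then show "\<exists>r\<in>insert v R. (r, y) \<in> (link (insert e F))\<^sup>*"
        using r(1) link_trans[OF link_sym[OF bv]] by blast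
    qed
    moreover have "finite F" using d fin finite_subset unfolding forests_def by blast
    moreover have "card (V - insert v R) = Suc (card (V - ?R))"
      using assms(3-5) fin
      by (metis Diff_insert Diff_iff card_Suc_Diff1 finite_Diff insert_commute insert_iff)
    ultimately show ?thesis using d x bv assms(4) unfolding linking_def forests_def by auto
  qed
  have inj: "inj_on ?f ?D"
  proof (rule inj_onI)
    fix x1 x2 assume x12: "x1 \<in> ?D" "x2 \<in> ?D" "?f x1 = ?f x2"
    obtain e1 s1 F1 where x1: "x1 = (e1, s1, F1)" by (metis prod_cases3)
    obtain e2 s2 F2 where x2: "x2 = (e2, s2, F2)" by (metis prod_cases3)
    note d1 = D[OF x12(1)[unfolded x1]] and d2 = D[OF x12(2)[unfolded x2]]
    have eq: "insert e1 F1 = insert e2 F2" using x12(3) x1 x2 by simp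
    have "e1 = e2"
    proof (rule ccontr)
      assume ne: "e1 \<noteq> e2"
      have e12: "e1 \<in> F2" "e2 \<in> F1" using eq ne by auto
      have sub: "F2 - {e1} \<subseteq> F1" using eq by blast
      have "(b, s1) \<in> (link F2)\<^sup>*" using linkI[OF e12(1)] d1 by simp
      then have s1: "(s1, v) \<notin> (link F2)\<^sup>*" using d2 link_trans[of b s1 F2 v] by blast
      have "(x, v) \<in> (link F2)\<^sup>*" if "(x, v) \<in> (link (F2 - {e1}))\<^sup>*" for x
        by (rule link_mono[OF _ that]) blast
      then have "(s2, v) \<in> (link (F2 - {e1}))\<^sup>*"
        using link_cut[of s2 v F2 e1 b s1] d1 d2 s1 by metis
      then have "(s2, v) \<in> (link F1)\<^sup>*" using link_mono[OF sub] by blast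
      moreover have "(b, s2) \<in> (link F1)\<^sup>*" using linkI[OF e12(2)] d2 by simp
      ultimately show False using d1 link_trans[of b s2 F1 v] by simp
    qed
    moreover have "F1 = F2" using eq d1 d2 calculation insert_ident[of e1 F1 F2] by simp
    moreover have "s1 = s2" using d1 d2 calculation(1) by (metis doubleton_eq_iff)
    ultimately show "x1 = x2" using x1 x2 by simp
  qed
  have sur: "F \<in> ?f ` ?D" if F: "F \<in> ?C" for F
  proof -
    have F1: "F \<subseteq> E" "card F = card (V - insert v R)" "spans V (insert v R) F" "(b, v) \<in> (link F)\<^sup>*"
      using F unfolding linking_def forests_def by auto
    obtain e s where e: "e \<in> F" "nd e = {b, s}" "s \<noteq> b" "(s, v) \<in> (link (F - {e}))\<^sup>*"
      using link_first_edge[OF F1(4)] assms(5) by metis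
    have "spans V ?R (F - {e})"
      unfolding spans_def
    proof
      fix y assume "y \<in> V"
      then obtain r where r: "r \<in> insert v R" "(r, y) \<in> (link F)\<^sup>*"
        using F1(3) unfolding spans_def by blast
      from link_cut[OF r(2) e(2)] show "\<exists>r\<in>?R. (r, y) \<in> (link (F - {e}))\<^sup>*"
        using r(1) link_trans[OF link_sym[OF e(4)]] by blast
    qed
    moreover have "card (V - insert v R) = Suc (card (V - ?R))"
      using assms(3-5) fin
      by (metis Diff_insert Diff_iff card_Suc_Diff1 finite_Diff insert_commute insert_iff)
    moreover have "card F = Suc (card (F - {e}))"
      using e(1) F1(1) fin by (metis card_Suc_Diff1 rev_finite_subset)
    ultimately have "F - {e} \<in> linking V E (insert b R) s v"
      using F1 e assms(4,5) unfolding linking_def forests_def by auto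
    then have "(e, s, F - {e}) \<in> ?D" using e F1 by auto
    moreover have "F = ?f (e, s, F - {e})" using e(1) by auto
    ultimately show ?thesis by (rule image_eqI[rotated])
  qed
  show ?thesis 
  proof (rule bij_betw_imageI[OF inj])
    have "?f ` ?D \<subseteq> ?C" using img by (rule image_subsetI)
    moreover have "?C \<subseteq> ?f ` ?D" using sur by (rule subsetI)
    ultimately show "?f ` ?D = ?C" by (rule equalityI)
  qed
qed

end

section \<open>Forest polynomials and their edge recursion\<close>

definition compl_poly :: "'e set set \<Rightarrow> 'e set \<Rightarrow> ('e \<Rightarrow> 'a::comm_ring_1) \<Rightarrow> 'a" where
  "compl_poly \<F> E \<alpha> = (\<Sum>F\<in>\<F>. \<Prod>e\<in>E - F. \<alpha> e)"

text \<open>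
  The same sum in the dual variables, conductances instead of resistances, in which Kirchhoff's laws
  are linear.
\<close>

definition subset_poly :: "'e set set \<Rightarrow> ('e \<Rightarrow> 'a::comm_ring_1) \<Rightarrow> 'a" where
  "subset_poly \<F> x = (\<Sum>F\<in>\<F>. \<Prod>e\<in>F. x e)"

lemma compl_poly_empty [simp]: "compl_poly {} E \<alpha> = 0"
  unfolding compl_poly_def by simp

lemma subset_poly_empty [simp]: "subset_poly {} x = 0"
  unfolding subset_poly_def by simp

lemma compl_poly_cong: "(\<And>e. e \<in> E \<Longrightarrow> \<alpha> e = \<beta> e) \<Longrightarrow> compl_poly \<F> E \<alpha> = compl_poly \<F> E \<beta>"
  unfolding compl_poly_def by (intro sum.cong prod.cong) auto

lemma compl_poly_split:
  assumes "finite E" and "e \<in> E" and "\<A> \<subseteq> Pow (E - {e})" and "\<B> \<subseteq> Pow (E - {e})"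
  shows "compl_poly (\<A> \<union> insert e ` \<B>) E \<alpha> = \<alpha> e * compl_poly \<A> (E - {e}) \<alpha> + compl_poly \<B> (E - {e}) \<alpha>"
proof -
  have fin: "finite \<A>" "finite \<B>" using assms by (auto intro: finite_subset)
  have inj: "inj_on (insert e) \<B>"
    by (rule inj_onI) (metis Diff_insert_absorb Pow_iff assms(4) insert_Diff insert_ident subsetD subset_Diff_insert)
  have "compl_poly (\<A> \<union> insert e ` \<B>) E \<alpha> = compl_poly \<A> E \<alpha> + compl_poly (insert e ` \<B>) E \<alpha>"
    unfolding compl_poly_def using fin assms(3) by (intro sum.union_disjoint) auto
  also have "compl_poly \<A> E \<alpha> = \<alpha> e * compl_poly \<A> (E - {e}) \<alpha>"
    unfolding compl_poly_def sum_distrib_left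
  proof (rule sum.cong[OF refl])
    fix F assume "F \<in> \<A>"
    then have "E - F = insert e (E - {e} - F)" "e \<notin> E - {e} - F" using assms by auto
    then show "(\<Prod>e\<in>E - F. \<alpha> e) = \<alpha> e * (\<Prod>e\<in>E - {e} - F. \<alpha> e)" using assms(1) by simp
  qed
  also have "compl_poly (insert e ` \<B>) E \<alpha> = compl_poly \<B> (E - {e}) \<alpha>"
    unfolding compl_poly_def sum.reindex[OF inj] comp_def
    by (intro sum.cong prod.cong) auto
  finally show ?thesis .
qed

lemma subset_poly_split:
  assumes "finite E" and "e \<in> E" and "\<A> \<subseteq> Pow (E - {e})" and "\<B> \<subseteq> Pow (E - {e})"
  shows "subset_poly (\<A> \<union> insert e ` \<B>) x = subset_poly \<A> x + x e * subset_poly \<B> x"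
proof -
  have fin: "finite \<A>" "finite \<B>" using assms by (auto intro: finite_subset)
  have inj: "inj_on (insert e) \<B>"
    by (rule inj_onI) (metis Diff_insert_absorb Pow_iff assms(4) insert_Diff insert_ident subsetD subset_Diff_insert)
  have "subset_poly (\<A> \<union> insert e ` \<B>) x = subset_poly \<A> x + subset_poly (insert e ` \<B>) x"
    unfolding subset_poly_def using fin assms(3) by (intro sum.union_disjoint) auto
  also have "subset_poly (insert e ` \<B>) x = x e * subset_poly \<B> x"
    unfolding subset_poly_def sum.reindex[OF inj] comp_def sum_distrib_left
  proof (rule sum.cong[OF refl])
    fix F assume "F \<in> \<B>"
    then have "F \<subseteq> E - {e}" using assms(4) by blast
    then have "e \<notin> F" "finite F" using assms(1) finite_subset[of F "E - {e}"] by auto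
    then show "(\<Prod>e\<in>insert e F. x e) = x e * (\<Prod>e\<in>F. x e)" by simp
  qed
  finally show ?thesis .
qed

lemma compl_poly_forests_split:
  assumes "edges_in nd V E" "e \<in> E" "nd e = {a, b}" "a \<in> R" "b \<notin> R"
  shows "compl_poly (forests nd V E R) E \<alpha> = \<alpha> e * compl_poly (forests nd V (E - {e}) R) (E - {e}) \<alpha>
    + compl_poly (forests nd V (E - {e}) (insert b R)) (E - {e}) \<alpha>"
  unfolding forests_split[OF assms]
  using assms(1,2) by (intro compl_poly_split forests_Pow) (auto simp: edges_in_def)

text \<open>
  An edge between two roots belongs to no forest.
\<close>

lemma compl_poly_forests_inside:
  assumes E: "edges_in nd V E" and RV: "R \<subseteq> V"
    and "e \<in> E" "nd e = {a, b}" "a \<in> R" "b \<in> R" "a \<noteq> b"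
  shows "compl_poly (forests nd V E R) E \<alpha> = \<alpha> e * compl_poly (forests nd V (E - {e}) R) (E - {e}) \<alpha>"
proof -
  have "e \<notin> F" if F: "F \<in> forests nd V E R" for F
    using forest_separates_roots[OF E RV F assms(5,6)] linkI[of e F nd a b] assms(4,7) by blast
  then have "forests nd V E R = forests nd V (E - {e}) R \<union> insert e ` {}"
    unfolding forests_def by auto
  moreover have "compl_poly (forests nd V (E - {e}) R \<union> insert e ` {}) E \<alpha> =
      \<alpha> e * compl_poly (forests nd V (E - {e}) R) (E - {e}) \<alpha> + compl_poly {} (E - {e}) \<alpha>"
    using E assms(3) by (intro compl_poly_split forests_Pow) (auto simp: edges_in_def)
  ultimately show ?thesis by simp
qed

section \<open>Linking forests as the Green function of the Laplacian\<close>

context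
  fixes nd :: "'e \<Rightarrow> 'v set"
begin

lemma subset_poly_forests_split:
  assumes "edges_in nd V E" "e \<in> E" "nd e = {a, b}" "a \<in> R" "b \<notin> R"
  shows "subset_poly (forests nd V E R) x =
    subset_poly (forests nd V (E - {e}) R) x + x e * subset_poly (forests nd V (E - {e}) (insert b R)) x"
  unfolding forests_split[OF assms]
  by (rule subset_poly_split[of E, OF _ assms(2) forests_Pow forests_Pow])
    (use assms(1) in \<open>simp add: edges_in_def\<close>)

lemma subset_poly_linking_split:
  assumes "edges_in nd V E" "R \<subseteq> V" "v \<in> V" "e \<in> E" "nd e = {a, b}" "a \<in> R" "b \<notin> R"
  shows "subset_poly (linking nd V E R p v) x =
    subset_poly (linking nd V (E - {e}) R p v) x + x e * subset_poly (linking nd V (E - {e}) (insert b R) p v) x"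
  unfolding linking_split[OF assms]
  by (rule subset_poly_split[of E, OF _ assms(4) linking_Pow linking_Pow])
    (use assms(1) in \<open>simp add: edges_in_def\<close>)

text \<open>
  The weighted Laplacian. In the inner sum only the end of \<open>e\<close> other than \<open>p\<close> contributes, and a
  self-loop contributes nothing; summing over all ends avoids naming the other end.
\<close>

definition laplace :: "'e set \<Rightarrow> ('e \<Rightarrow> 'a::comm_ring_1) \<Rightarrow> ('v \<Rightarrow> 'a) \<Rightarrow> 'v \<Rightarrow> 'a" where
  "laplace E x g p = (\<Sum>e\<in>{e\<in>E. p \<in> nd e}. x e * (\<Sum>s\<in>nd e. g p - g s))"

lemma laplace_add: "laplace E x (\<lambda>p. g p + h p) p = laplace E x g p + laplace E x h p"
  unfolding laplace_def
  by (simp add: sum.distrib sum_subtractf algebra_simps)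

lemma laplace_mult: "laplace E x (\<lambda>p. c * g p) p = c * laplace E x g p"
  unfolding laplace_def sum_distrib_left
  by (intro sum.cong refl) (simp add: algebra_simps)

lemma laplace_self_adjoint:
  assumes "edges_in nd V E"
  shows "(\<Sum>p\<in>V. f p * laplace E x g p) = (\<Sum>p\<in>V. g p * laplace E x f p)"
proof -
  have fin: "finite V" "finite E" using assms unfolding edges_in_def by auto
  have ndV: "nd e \<subseteq> V" if "e \<in> E" for e by (rule edges_in_subset[OF assms that])
  have form: "(\<Sum>p\<in>V. f p * laplace E x g p) =
      (\<Sum>e\<in>E. x e * ((\<Sum>p\<in>nd e. \<Sum>s\<in>nd e. f p * g p) - (\<Sum>p\<in>nd e. f p) * (\<Sum>s\<in>nd e. g s)))"
    for f g :: "'v \<Rightarrow> 'a"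
  proof -
    have "(\<Sum>p\<in>V. f p * laplace E x g p) =
        (\<Sum>p\<in>V. \<Sum>e\<in>{e\<in>E. p \<in> nd e}. x e * (\<Sum>s\<in>nd e. f p * (g p - g s)))"
      unfolding laplace_def by (simp add: sum_distrib_left algebra_simps)
    also have "\<dots> = (\<Sum>e\<in>E. \<Sum>p\<in>{p\<in>V. p \<in> nd e}. x e * (\<Sum>s\<in>nd e. f p * (g p - g s)))"
      by (rule sum.swap_restrict) (use fin in auto)
    also have "\<dots> = (\<Sum>e\<in>E. x e * (\<Sum>p\<in>nd e. \<Sum>s\<in>nd e. f p * (g p - g s)))"
    proof (rule sum.cong[OF refl])
      fix e assume "e \<in> E"
      then have "{p\<in>V. p \<in> nd e} = nd e" using ndV by blast
      then show "(\<Sum>p\<in>{p\<in>V. p \<in> nd e}. x e * (\<Sum>s\<in>nd e. f p * (g p - g s))) =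
          x e * (\<Sum>p\<in>nd e. \<Sum>s\<in>nd e. f p * (g p - g s))" by (simp add: sum_distrib_left)
    qed
    also have "\<dots> = (\<Sum>e\<in>E. x e * ((\<Sum>p\<in>nd e. \<Sum>s\<in>nd e. f p * g p) - (\<Sum>p\<in>nd e. f p) * (\<Sum>s\<in>nd e. g s)))"
      by (simp add: right_diff_distrib sum_subtractf sum_product)
    finally show ?thesis .
  qed
  show ?thesis unfolding form by (simp add: mult.commute)
qed

text \<open>
  Kirchhoff's law at the root \<open>b\<close>: the current that leaves the network at \<open>b\<close>. It is the
  weighted count of \<open>linking_first_edge_bij\<close>, since the potential vanishes at \<open>b\<close> itself.
\<close>

lemma green_first_edge:
  assumes "edges_in nd V E" and "R \<subseteq> V" and "b \<in> V - R" and "v \<in> V - R" and "b \<noteq> v"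
  shows "subset_poly (linking nd V E R b v) x =
    - laplace E x (\<lambda>p. subset_poly (linking nd V E (insert b R) p v) x) b"
proof -
  let ?L = "\<lambda>s. linking nd V E (insert b R) s v"
  define I where "I = {e\<in>E. b \<in> nd e}"
  define D where "D = Sigma I (\<lambda>e. Sigma (nd e) ?L)"
  have fin: "finite V" "finite E" using assms unfolding edges_in_def by auto
  have finI: "finite I" using fin unfolding I_def by simp
  have fn: "finite (nd e)" if "e \<in> I" for e
    using finite_subset[OF edges_in_subset[OF assms(1)] fin(1)] that unfolding I_def by blast
  have fl: "finite (?L s)" for s
    by (rule finite_subset[OF linking_Pow]) (use fin in simp)
  have nob: "?L b = {}"
    by (rule linking_empty_root) (use assms in auto)
  have ne: "e \<notin> F \<and> finite F" if d: "e \<in> I" "s \<in> nd e" "F \<in> ?L s" for e s F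
  proof
    show "finite F" by (rule finite_subset[OF _ fin(2)]) (use d(3) linking_Pow[of nd V E "insert b R" s v] in blast)
    show "e \<notin> F"
    proof
      assume "e \<in> F"
      have "s \<noteq> b" using d(3) nob by auto
      then have "nd e = {b, s}" using d edges_in_pair[OF assms(1)] unfolding I_def by simp
      then have "(b, s) \<in> (link nd F)\<^sup>*" by (rule linkI[OF \<open>e \<in> F\<close>])
      moreover have "(s, v) \<in> (link nd F)\<^sup>*" using d(3) unfolding linking_def by simp
      ultimately have "(b, v) \<in> (link nd F)\<^sup>*" by (rule link_trans)
      then have "F \<in> ?L b" using d(3) unfolding linking_def by simp
      then show False using nob by simp
    qed
  qed
  have D: "{(e, s, F). e \<in> E \<and> b \<in> nd e \<and> s \<in> nd e \<and> F \<in> ?L s} = D"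
    unfolding D_def I_def by auto
  have "subset_poly (linking nd V E R b v) x = (\<Sum>d\<in>D. \<Prod>e\<in>(\<lambda>(e, s, F). insert e F) d. x e)"
    unfolding subset_poly_def
    by (rule sum.reindex_bij_betw[OF linking_first_edge_bij[OF assms, unfolded D], symmetric])
  also have "\<dots> = (\<Sum>(e, s, F)\<in>D. x e * (\<Prod>e\<in>F. x e))"
  proof (rule sum.cong[OF refl])
    fix d assume "d \<in> D"
    then obtain e s F where d: "d = (e, s, F)" "e \<in> I" "s \<in> nd e" "F \<in> ?L s"
      unfolding D_def by (elim SigmaE) simp
    show "(\<Prod>e\<in>(\<lambda>(e, s, F). insert e F) d. x e) = (case d of (e, s, F) \<Rightarrow> x e * (\<Prod>e\<in>F. x e))"
      using ne[OF d(2-4)] unfolding d(1) by simp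
  qed
  also have "\<dots> = (\<Sum>e\<in>I. \<Sum>(s, F)\<in>Sigma (nd e) ?L. x e * (\<Prod>e\<in>F. x e))"
    unfolding D_def
    using finI fn fl by (simp add: sum.Sigma finite_SigmaI)
  also have "\<dots> = (\<Sum>e\<in>I. \<Sum>s\<in>nd e. \<Sum>F\<in>?L s. x e * (\<Prod>e\<in>F. x e))"
    using fn fl by (intro sum.cong refl) (simp add: sum.Sigma)
  also have "\<dots> = (\<Sum>e\<in>I. x e * (\<Sum>s\<in>nd e. subset_poly (?L s) x))"
    by (simp add: subset_poly_def sum_distrib_left)
  also have "\<dots> = - laplace E x (\<lambda>p. subset_poly (?L p) x) b"
    unfolding laplace_def nob I_def[symmetric] by (simp add: sum_negf)
  finally show ?thesis .
qed

lemma laplace_split: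
  assumes "edges_in nd V E" and "e \<in> E" and "nd e = {a, b}" and "a \<noteq> b"
  shows "laplace E x g p = laplace (E - {e}) x g p +
    (if p = b then x e * (g b - g a) else if p = a then x e * (g a - g b) else 0)"
proof -
  have fin: "finite E" using assms unfolding edges_in_def by auto
  show ?thesis
  proof (cases "p \<in> nd e")
    case True
    then have "{e\<in>E. p \<in> nd e} = insert e {e'\<in>E-{e}. p \<in> nd e'}" using assms by auto
    then show ?thesis unfolding laplace_def using fin True assms(3,4) by auto
  next
    case False
    then have "{e\<in>E. p \<in> nd e} = {e'\<in>E-{e}. p \<in> nd e'}" by auto
    then show ?thesis unfolding laplace_def using False assms(3) by auto
  qed
qed

text \<open>
  The linking forests are the Green function of the Laplacian with Dirichlet condition on \<open>R\<close>, up to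
  the factor \<open>\<Psi>\<^sub>R\<close>. Remove an edge \<open>e\<close> from \<open>R\<close> to \<open>b\<close>: at vertices other than \<open>b\<close> both terms of
  the recursion satisfy Kirchhoff's law by induction, and at \<open>b\<close> the defect of the second term is
  the current of \<open>green_first_edge\<close>. Without such an edge the potential is constant off \<open>R\<close>.
\<close>

lemma green_kirchhoff:
  assumes "edges_in nd V E" and "R \<subseteq> V" and "p \<in> V - R" and "v \<in> V - R"
  shows "laplace E x (\<lambda>p. subset_poly (linking nd V E R p v) x) p =
    (if p = v then subset_poly (forests nd V E R) x else 0)"
  using assms
proof (induction "card E" arbitrary: E R p rule: less_induct)
  case less
  note E = less.prems(1) and RV = less.prems(2) and p = less.prems(3) and v = less.prems(4)
  have fin: "finite V" "finite E" using E unfolding edges_in_def by auto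
  show ?case
  proof (cases "\<exists>e\<in>E. \<exists>a\<in>R. \<exists>b\<in>V - R. nd e = {a, b}")
    case True
    then obtain e a b where e: "e \<in> E" "a \<in> R" "b \<in> V - R" "nd e = {a, b}" by blast
    let ?E = "E - {e}" and ?S = "insert b R"
    let ?g1 = "\<lambda>p. subset_poly (linking nd V ?E R p v) x"
    let ?g2 = "\<lambda>p. subset_poly (linking nd V ?E ?S p v) x"
    have E': "edges_in nd V ?E" using edges_in_mono[OF E] by blast
    have lt: "card ?E < card E" using fin e(1) by (intro card_Diff1_less)
    have ab: "a \<noteq> b" using e by blast
    have SV: "?S \<subseteq> V" using e RV by blast
    have g: "subset_poly (linking nd V E R q v) x = ?g1 q + x e * ?g2 q" for q
      using subset_poly_linking_split[OF E RV _ e(1,4,2)] e(3) v by blast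
    have k: "subset_poly (forests nd V E R) x =
        subset_poly (forests nd V ?E R) x + x e * subset_poly (forests nd V ?E ?S) x"
      using subset_poly_forests_split[OF E e(1,4,2)] e(3) by blast
    have lap: "laplace ?E x (\<lambda>q. subset_poly (linking nd V E R q v) x) p =
        laplace ?E x ?g1 p + x e * laplace ?E x ?g2 p"
      unfolding g laplace_add laplace_mult by simp
    have IH1: "laplace ?E x ?g1 p = (if p = v then subset_poly (forests nd V ?E R) x else 0)"
      by (rule less.hyps[OF lt E' RV p v])
    have g2b: "linking nd V ?E ?S q v = {}" if "v = b" for q
      using that unfolding linking_def by auto
    show ?thesis
    proof (cases "p = b")
      case False
      have "p \<noteq> a" using p e by blast
      then have 1: "laplace E x (\<lambda>q. subset_poly (linking nd V E R q v) x) p =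
          laplace ?E x ?g1 p + x e * laplace ?E x ?g2 p"
        using laplace_split[OF E e(1,4) ab, of x _ p] False lap by simp
      show ?thesis
      proof (cases "v = b")
        case True
        then show ?thesis unfolding 1 IH1 using False g2b by (simp add: laplace_def)
      next
        case vb: False
        have "laplace ?E x ?g2 p = (if p = v then subset_poly (forests nd V ?E ?S) x else 0)"
          by (rule less.hyps[OF lt E' SV]) (use p v False vb in auto)
        then show ?thesis unfolding 1 IH1 k by simp
      qed
    next
      case True
      have ga: "linking nd V E R a v = {}"
        by (rule linking_empty_root[OF E RV _ e(2)]) (use v in blast)
      have gb: "linking nd V ?E ?S b v = {}"
        by (rule linking_empty_root[OF E' SV]) (use v in auto)
      have 1: "laplace E x (\<lambda>q. subset_poly (linking nd V E R q v) x) p =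
          laplace ?E x ?g1 p + x e * (laplace ?E x ?g2 b + ?g1 b)"
        unfolding laplace_split[OF E e(1,4) ab, of x _ p] lap
        using True ga gb g[of b] by (simp add: algebra_simps)
      \<comment> \<open>The summand \<open>?g1 b\<close> is the potential difference along \<open>e\<close>, whose other end is a root.\<close>
      have "laplace ?E x ?g2 b + ?g1 b = (if p = v then subset_poly (forests nd V ?E ?S) x else 0)"
      proof (cases "v = b")
        case vb: True
        have "?g1 b = subset_poly (forests nd V ?E ?S) x"
          unfolding vb using linking_self[of b R nd V ?E] e(3) by auto
        then show ?thesis using True vb g2b by (simp add: laplace_def)
      next
        case vb: False
        then show ?thesis
          using green_first_edge[OF E' RV e(3) v, of x] True by simp
      qed
      then show ?thesis unfolding 1 IH1 k by simp
    qed
  next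
    case False
    have k: "forests nd V E R = {}"
      by (rule forests_empty[OF E]) (use False p in auto)
    have const: "linking nd V E R q v = forests nd V E (insert v R)" if q: "q \<in> V - R" for q
    proof -
      have "(q, v) \<in> (link nd F)\<^sup>*" if F: "F \<in> forests nd V E (insert v R)" for F
      proof -
        have FE: "F \<subseteq> E" using F unfolding forests_def by blast
        obtain r where r: "r \<in> insert v R" "(r, q) \<in> (link nd F)\<^sup>*"
          using F q unfolding forests_def spans_def by blast
        have "r \<notin> R"
        proof
          assume "r \<in> R"
          then obtain e a b where e: "e \<in> F" "a \<in> R" "b \<notin> R" "nd e = {a, b}"
            using crossing_edge[OF r(2), of R] q by auto
          then have "b \<in> V - R" using edges_in_ends[OF E _ e(4)] FE by auto
          then show False using False FE e by blast
        qed
        then have "r = v" using r(1) by simp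
        then show ?thesis using link_sym[OF r(2)] by simp
      qed
      then show ?thesis using v unfolding linking_def by auto
    qed
    have "s \<in> V - R" if "e \<in> E" "p \<in> nd e" "s \<in> nd e" for e s
    proof (rule ccontr)
      assume s: "s \<notin> V - R"
      have "s \<in> V" using that edges_in_subset[OF E] by blast
      then have "s \<in> R" "s \<noteq> p" using s p by auto
      moreover have "nd e = {s, p}"
        using edges_in_pair[OF E that \<open>s \<noteq> p\<close>] by (simp add: insert_commute)
      ultimately show False using False that p by blast
    qed
    then have "subset_poly (linking nd V E R p v) x - subset_poly (linking nd V E R s v) x = 0"
      if "e \<in> E" "p \<in> nd e" "s \<in> nd e" for e s
      using that const p by (metis cancel_comm_monoid_add_class.diff_cancel)
    then have "(\<Sum>s\<in>nd e. subset_poly (linking nd V E R p v) x - subset_poly (linking nd V E R s v) x) = 0"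
      if "e \<in> E" "p \<in> nd e" for e
      using that by (intro sum.neutral ballI) blast
    then have "laplace E x (\<lambda>p. subset_poly (linking nd V E R p v) x) p = 0"
      unfolding laplace_def by (intro sum.neutral ballI) simp
    then show ?thesis using k by simp
  qed
qed

text \<open>
  This is the identity of Dodgson and Jacobi for the principal minors and one off-diagonal minor of
  the Laplacian, proved without determinants. The function \<open>\<Delta>\<close> in the proof compares the Green
  function for the roots \<open>R\<close> and \<open>w\<close> with the combination of Green functions for \<open>R\<close> that
  vanishes at \<open>w\<close>. It is harmonic off the roots and vanishes on them, hence is zero by
  self-adjointness of the Laplacian.
\<close>

lemma dodgson_conductance:
  fixes x :: "'e \<Rightarrow> 'a::idom"
  assumes E: "edges_in nd V E" and RV: "R \<subseteq> V" and v: "v \<in> V - R" and w: "w \<in> V - R" and "v \<noteq> w"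
    and nz: "subset_poly (forests nd V E (insert w R)) x \<noteq> 0"
  shows "subset_poly (forests nd V E R) x * subset_poly (forests nd V E (insert v (insert w R))) x =
    subset_poly (forests nd V E (insert v R)) x * subset_poly (forests nd V E (insert w R)) x
      - (subset_poly (linking nd V E R v w) x)\<^sup>2"
proof -
  let ?S = "insert w R"
  let ?k = "subset_poly (forests nd V E R) x" and ?kw = "subset_poly (forests nd V E ?S) x"
  let ?g = "\<lambda>p v. subset_poly (linking nd V E R p v) x"
  let ?h = "\<lambda>p. subset_poly (linking nd V E ?S p v) x"
  have fin: "finite V" using E unfolding edges_in_def by auto
  have SV: "?S \<subseteq> V" using RV w by blast
  have vS: "v \<in> V - ?S" using v \<open>v \<noteq> w\<close> by blast
  \<comment> \<open>The second summand equals \<open>- ?kw * ?g p v + ?g p w * ?g w v\<close>, which vanishes for \<open>p = w\<close>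
    because \<open>?g w w = ?kw\<close>.\<close>
  define \<Delta> where "\<Delta> p = ?k * ?h p + ((- ?kw) * ?g p v + ?g w v * ?g p w)" for p
  have h0: "?h p = 0" if "p \<in> ?S" for p
    using linking_empty_root[OF E SV _ that, of v] v by simp
  have g0: "?g p u = 0" if "p \<in> R" "u \<in> V" for p u
    using linking_empty_root[OF E RV _ that(1), of u] that by simp
  have gww: "?g w w = ?kw" using linking_self[of w R nd V E] w by simp
  have \<Delta>0: "\<Delta> p = 0" if "p \<in> ?S" for p
  proof (cases "p = w")
    case True
    then show ?thesis unfolding \<Delta>_def using h0[of w] gww by simp
  next
    case False
    then show ?thesis unfolding \<Delta>_def using h0[of p] g0[of p] that v w by simp
  qed
  have lap: "laplace E x \<Delta> p = 0" if p: "p \<in> V - ?S" for p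
  proof -
    have pR: "p \<in> V - R" "p \<noteq> w" using p by auto
    have "laplace E x \<Delta> p = ?k * laplace E x ?h p +
        ((- ?kw) * laplace E x (\<lambda>p. ?g p v) p + ?g w v * laplace E x (\<lambda>p. ?g p w) p)"
      unfolding \<Delta>_def laplace_add laplace_mult by simp
    also have "\<dots> = 0"
      unfolding green_kirchhoff[OF E SV p vS] green_kirchhoff[OF E RV pR(1) v]
        green_kirchhoff[OF E RV pR(1) w] using pR(2) by simp
    finally show ?thesis .
  qed
  have "(\<Sum>p\<in>V. ?h p * laplace E x \<Delta> p) = 0"
    by (rule sum.neutral) (metis DiffI h0 lap mult_zero_left mult_zero_right)
  then have "0 = (\<Sum>p\<in>V. \<Delta> p * laplace E x ?h p)"
    using laplace_self_adjoint[OF E, of ?h x \<Delta>] by simp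
  also have "\<dots> = (\<Sum>p\<in>V. if p = v then \<Delta> v * ?kw else 0)"
  proof (rule sum.cong[OF refl])
    fix p assume "p \<in> V"
    show "\<Delta> p * laplace E x ?h p = (if p = v then \<Delta> v * ?kw else 0)"
    proof (cases "p \<in> ?S")
      case True
      then show ?thesis using \<Delta>0 vS by auto
    next
      case False
      then have "p \<in> V - ?S" using \<open>p \<in> V\<close> by blast
      then show ?thesis using green_kirchhoff[OF E SV _ vS, of p x] by simp
    qed
  qed
  also have "\<dots> = \<Delta> v * ?kw" using fin v by simp
  finally have "\<Delta> v = 0" using nz by simp
  moreover have "?h v = subset_poly (forests nd V E (insert v ?S)) x"
    using linking_self[of v ?S nd V E] vS by simp
  moreover have "?g v v = subset_poly (forests nd V E (insert v R)) x"
    using linking_self[of v R nd V E] v by simp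
  moreover have "?g w v = ?g v w" using linking_commute[OF fin w v, of nd E] by simp
  ultimately show ?thesis unfolding \<Delta>_def by (simp add: power2_eq_square algebra_simps)
qed

end

section \<open>The Dodgson identity for forest polynomials\<close>

text \<open>
  The passage between the two kinds of variables without division: instead of \<open>1 / \<alpha> e\<close> the
  conductance of \<open>e\<close> is the product of all other \<open>\<alpha>\<close>, which differs from it by the factor
  \<open>prod \<alpha> E\<close>.
\<close>

lemma subset_poly_cofactor:
  assumes "finite E" and "\<F> \<subseteq> Pow E" and "\<And>F. F \<in> \<F> \<Longrightarrow> card F = k"
  shows "prod \<alpha> E * subset_poly \<F> (\<lambda>e. prod \<alpha> (E - {e})) = prod \<alpha> E ^ k * compl_poly \<F> E \<alpha>"
  unfolding subset_poly_def compl_poly_def sum_distrib_left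
proof (rule sum.cong[OF refl])
  fix F assume F: "F \<in> \<F>"
  then have FE: "F \<subseteq> E" using assms(2) by blast
  have "prod \<alpha> F * (\<Prod>e\<in>F. prod \<alpha> (E - {e})) = (\<Prod>e\<in>F. prod \<alpha> E)"
    unfolding prod.distrib[symmetric]
    using FE assms(1) by (intro prod.cong refl) (metis prod.remove subsetD)
  also have "\<dots> = prod \<alpha> E ^ k" using assms(3)[OF F] by simp
  finally have "prod \<alpha> F * (\<Prod>e\<in>F. prod \<alpha> (E - {e})) = prod \<alpha> E ^ k" .
  moreover have "prod \<alpha> E = prod \<alpha> (E - F) * prod \<alpha> F"
    by (rule prod.subset_diff[OF FE assms(1)])
  ultimately show "prod \<alpha> E * (\<Prod>e\<in>F. prod \<alpha> (E - {e})) = prod \<alpha> E ^ k * prod \<alpha> (E - F)"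
    by (metis mult.assoc mult.commute)
qed

text \<open>
  The summand of \<open>F\<close> is monic in \<open>t\<close>, and its degree has the complement of \<open>F\<close> as its set of
  binary digits. Distinct forests thus give distinct degrees, and the leading term of the largest
  one cannot cancel, whatever the characteristic.
\<close>

lemma compl_poly_generic_nonzero:
  fixes a :: "'e \<Rightarrow> 'a::idom"
  assumes "finite E" and "\<F> \<subseteq> Pow E" and "\<F> \<noteq> {}" and "inj_on i E"
  shows "compl_poly \<F> E (\<lambda>e. [:a e:] + monom 1 (2 ^ i e)) \<noteq> 0"
proof -
  define \<alpha> where "\<alpha> e = [:a e:] + monom 1 (2 ^ i e)" for e
  define d where "d F = (\<Sum>e\<in>E - F. (2::nat) ^ i e)" for F
  have fin: "finite \<F>" using assms(1,2) finite_subset by auto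
  have deg: "degree (\<alpha> e) = 2 ^ i e \<and> lead_coeff (\<alpha> e) = 1" for e
  proof -
    have "degree [:a e:] < degree (monom (1::'a) (2 ^ i e))" by (simp add: degree_monom_eq)
    then show ?thesis unfolding \<alpha>_def
      by (simp add: degree_add_eq_right degree_monom_eq coeff_eq_0)
  qed
  then have nz: "\<alpha> e \<noteq> 0" for e by (metis leading_coeff_0_iff one_neq_zero)
  have degF: "degree (prod \<alpha> (E - F)) = d F" for F
    unfolding d_def using deg nz by (subst degree_prod_eq_sum_degree) auto
  have lcF: "coeff (prod \<alpha> (E - F)) (d F) = 1" for F
    unfolding degF[symmetric] lead_coeff_prod by (rule prod.neutral) (use deg in blast)
  have d_inj: "F = F'" if "F \<in> \<F>" "F' \<in> \<F>" "d F = d F'" for F F'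
  proof -
    have enc: "d X = set_encode (i ` (E - X))" for X
      unfolding d_def set_encode_def
      by (subst sum.reindex) (use assms(4) in \<open>auto intro: inj_on_subset\<close>)
    have "i ` (E - F) = i ` (E - F')"
      using that(3) assms(1) unfolding enc by (subst (asm) set_encode_eq) auto
    then have "E - F = E - F'" using inj_on_image_eq_iff[OF assms(4)] by blast
    then show ?thesis using that(1,2) assms(2) by blast
  qed
  obtain F0 where F0: "F0 \<in> \<F>" "\<And>F. F \<in> \<F> \<Longrightarrow> d F \<le> d F0"
  proof -
    have "Max (d ` \<F>) \<in> d ` \<F>" using fin assms(3) by (intro Max_in) auto
    then obtain F0 where "F0 \<in> \<F>" "d F0 = Max (d ` \<F>)" by auto
    then show ?thesis using that[of F0] fin by simp
  qed
  have "coeff (compl_poly \<F> E \<alpha>) (d F0) = (\<Sum>F\<in>\<F>. if F = F0 then 1 else 0)"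
    unfolding compl_poly_def coeff_sum
  proof (rule sum.cong[OF refl])
    fix F assume F: "F \<in> \<F>"
    show "coeff (prod \<alpha> (E - F)) (d F0) = (if F = F0 then 1 else 0)"
    proof (cases "F = F0")
      case False
      then have "d F < d F0" using F0 F d_inj le_neq_implies_less by blast
      then show ?thesis using False degF[of F] by (simp add: coeff_eq_0)
    qed (simp add: lcF)
  qed
  also have "\<dots> = 1" using fin F0(1) by simp
  finally have "compl_poly \<F> E \<alpha> \<noteq> 0" by auto
  then show ?thesis unfolding \<alpha>_def .
qed

text \<open>
  Transfer of \<open>dodgson_conductance\<close> to a generic point over the polynomial ring, followed by
  specialisation. If no forest has the roots \<open>R\<close> and \<open>w\<close>, then every product in the identity
  contains an empty sum.
\<close>

lemma dodgson_forests:
  fixes a :: "'e \<Rightarrow> 'a::idom" and nd :: "'e \<Rightarrow> 'v set"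
  assumes E: "edges_in nd V E" and RV: "R \<subseteq> V" and v: "v \<in> V - R" and w: "w \<in> V - R" and "v \<noteq> w"
  shows "compl_poly (forests nd V E R) E a * compl_poly (forests nd V E (insert v (insert w R))) E a =
    compl_poly (forests nd V E (insert v R)) E a * compl_poly (forests nd V E (insert w R)) E a
      - (compl_poly (linking nd V E R v w) E a)\<^sup>2"
proof (cases "forests nd V E (insert w R) = {}")
  case True
  have "linking nd V E R v w = {}" using True unfolding linking_def by blast
  moreover have "forests nd V E R = {}"
  proof (rule ccontr)
    assume "forests nd V E R \<noteq> {}"
    then obtain F where F: "F \<subseteq> E" "spans nd V R F" unfolding forests_def by blast
    then have "spans nd V (insert w R) F" unfolding spans_def by blast
    then have "forests nd V F (insert w R) \<noteq> {}"
      using forest_exists edges_in_mono[OF E F(1)] by blast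
    then show False using True F(1) unfolding forests_def by blast
  qed
  ultimately show ?thesis using True by simp
next
  case False
  have fin: "finite V" "finite E" using E unfolding edges_in_def by auto
  obtain i :: "'e \<Rightarrow> nat" where i: "inj_on i E" using fin(2) finite_imp_inj_to_nat_seg by metis
  define \<alpha> where "\<alpha> e = [:a e:] + monom 1 (2 ^ i e)" for e
  define x where "x e = prod \<alpha> (E - {e})" for e
  define P where "P = prod \<alpha> E"
  define n where "n = card (V - insert v (insert w R))"
  let ?\<Psi> = "\<lambda>\<F>. compl_poly \<F> E \<alpha>" and ?k = "\<lambda>\<F>. subset_poly \<F> x"
  let ?A = "forests nd V E R" and ?B = "forests nd V E (insert v (insert w R))"
  let ?C = "forests nd V E (insert v R)" and ?D = "forests nd V E (insert w R)"
  let ?L = "linking nd V E R v w"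
  have card1: "card (V - insert w R) = Suc n"
    unfolding n_def using v \<open>v \<noteq> w\<close> fin by (metis DiffE DiffI Diff_insert card_Suc_Diff1 finite_Diff insertE)
  have card2: "card (V - insert v R) = Suc n"
    unfolding n_def insert_commute[of v w]
    using w \<open>v \<noteq> w\<close> fin by (metis DiffE DiffI Diff_insert card_Suc_Diff1 finite_Diff insertE)
  have card0: "card (V - R) = Suc (Suc n)"
    unfolding card1[symmetric] using w fin by (metis Diff_insert card_Suc_Diff1 finite_Diff)
  have conv: "P * ?k \<F> = P ^ k * ?\<Psi> \<F>" if "\<F> \<subseteq> Pow E" "\<And>F. F \<in> \<F> \<Longrightarrow> card F = k" for \<F> k
    unfolding P_def x_def by (rule subset_poly_cofactor[OF fin(2) that])
  have cA: "P * ?k ?A = P ^ Suc (Suc n) * ?\<Psi> ?A"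
    by (rule conv[OF forests_Pow]) (simp add: forests_def card0)
  have cB: "P * ?k ?B = P ^ n * ?\<Psi> ?B"
    by (rule conv[OF forests_Pow]) (simp add: forests_def n_def)
  have cC: "P * ?k ?C = P ^ Suc n * ?\<Psi> ?C"
    by (rule conv[OF forests_Pow]) (simp add: forests_def card2)
  have cD: "P * ?k ?D = P ^ Suc n * ?\<Psi> ?D"
    by (rule conv[OF forests_Pow]) (simp add: forests_def card1)
  have cL: "P * ?k ?L = P ^ Suc n * ?\<Psi> ?L"
    by (rule conv[OF linking_Pow]) (simp add: linking_def forests_def card1)
  have P0: "P \<noteq> 0"
    using compl_poly_generic_nonzero[OF fin(2) _ _ i, of "{{}}" a]
    unfolding P_def \<alpha>_def compl_poly_def by simp
  have "?\<Psi> ?D \<noteq> 0"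
    unfolding \<alpha>_def by (rule compl_poly_generic_nonzero[OF fin(2) forests_Pow False i])
  then have "P * ?k ?D \<noteq> 0" unfolding cD using P0 by simp
  then have "?k ?D \<noteq> 0" by auto
  from dodgson_conductance[OF E RV v w \<open>v \<noteq> w\<close> this]
  have "(P * ?k ?A) * (P * ?k ?B) = (P * ?k ?C) * (P * ?k ?D) - (P * ?k ?L)\<^sup>2"
    by (simp add: power2_eq_square algebra_simps) (metis distrib_left mult.assoc)
  then have "(P ^ Suc n)\<^sup>2 * (?\<Psi> ?A * ?\<Psi> ?B) = (P ^ Suc n)\<^sup>2 * (?\<Psi> ?C * ?\<Psi> ?D - (?\<Psi> ?L)\<^sup>2)"
    unfolding cA cB cC cD cL by (simp add: power2_eq_square algebra_simps)
  then have eq: "?\<Psi> ?A * ?\<Psi> ?B = ?\<Psi> ?C * ?\<Psi> ?D - (?\<Psi> ?L)\<^sup>2" using P0 by simp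
  have at0: "poly (?\<Psi> \<F>) 0 = compl_poly \<F> E a" for \<F>
    unfolding compl_poly_def poly_sum poly_prod \<alpha>_def by (simp add: poly_monom power_0_left)
  have "poly (?\<Psi> ?A * ?\<Psi> ?B) 0 = poly (?\<Psi> ?C * ?\<Psi> ?D - (?\<Psi> ?L)\<^sup>2) 0" unfolding eq ..
  then show ?thesis by (simp add: at0)
qed

section \<open>Counting nonzeros of affine and multilinear polynomials\<close>

lemma card_PiE_insert:
  fixes E :: "'e set"
  assumes "finite E" and "e \<notin> E"
  shows "card {\<alpha> \<in> insert e E \<rightarrow>\<^sub>E (UNIV :: 'f::finite set). Q \<alpha>} =
    (\<Sum>\<beta>\<in>E \<rightarrow>\<^sub>E UNIV. card {t. Q (\<beta>(e := t))})"
proof -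
  let ?S = "SIGMA \<beta>:E \<rightarrow>\<^sub>E (UNIV :: 'f set). {t. Q (\<beta>(e := t))}"
  have inj: "inj_on (\<lambda>(\<beta>, t). \<beta>(e := t)) ?S"
  proof (rule inj_onI, clarify)
    fix \<beta> \<gamma> :: "'e \<Rightarrow> 'f" and t s
    assume *: "\<beta> \<in> E \<rightarrow>\<^sub>E UNIV" "\<gamma> \<in> E \<rightarrow>\<^sub>E UNIV" "\<beta>(e := t) = \<gamma>(e := s)"
    have "\<beta> e = \<gamma> e" using * assms(2) by (auto simp: PiE_def extensional_def)
    moreover have "\<beta> y = \<gamma> y" if "y \<noteq> e" for y using fun_cong[OF *(3), of y] that by simp
    ultimately have "\<beta> = \<gamma>" by (intro ext) metis
    moreover have "t = s" using fun_cong[OF *(3), of e] by simp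
    ultimately show "\<beta> = \<gamma> \<and> t = s" by simp
  qed
  have "{\<alpha> \<in> insert e E \<rightarrow>\<^sub>E (UNIV :: 'f set). Q \<alpha>} = (\<lambda>(\<beta>, t). \<beta>(e := t)) ` ?S"
  proof (intro equalityI subsetI)
    fix \<alpha> assume \<alpha>: "\<alpha> \<in> {\<alpha> \<in> insert e E \<rightarrow>\<^sub>E (UNIV :: 'f set). Q \<alpha>}"
    then have "\<alpha>(e := undefined) \<in> E \<rightarrow>\<^sub>E UNIV" using assms(2) by (auto simp: PiE_def extensional_def)
    then show "\<alpha> \<in> (\<lambda>(\<beta>, t). \<beta>(e := t)) ` ?S"
      using \<alpha> by (intro image_eqI[of _ _ "(\<alpha>(e := undefined), \<alpha> e)"]) auto
  next
    fix \<alpha> assume "\<alpha> \<in> (\<lambda>(\<beta>, t). \<beta>(e := t)) ` ?S"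
    then show "\<alpha> \<in> {\<alpha> \<in> insert e E \<rightarrow>\<^sub>E (UNIV :: 'f set). Q \<alpha>}"
      by (auto simp: PiE_def extensional_def)
  qed
  then have "card {\<alpha> \<in> insert e E \<rightarrow>\<^sub>E (UNIV :: 'f set). Q \<alpha>} = card ?S"
    using card_image[OF inj] by simp
  also have "\<dots> = (\<Sum>\<beta>\<in>E \<rightarrow>\<^sub>E UNIV. card {t. Q (\<beta>(e := t))})"
    using assms(1) by (subst card_SigmaI) (auto intro: finite_PiE)
  finally show ?thesis .
qed

lemma card_affine_nonzero:
  fixes g h :: "'f::{field,finite}"
  shows "int (card {t. t * g + h \<noteq> 0}) = int CARD('f) * of_bool (\<not> (g = 0 \<and> h = 0)) - of_bool (g \<noteq> 0)"
proof (cases "g = 0")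
  case True
  then show ?thesis by (cases "h = 0") auto
next
  case False
  then have "{t. t * g + h \<noteq> 0} = UNIV - {- h / g}"
    by (auto simp: field_simps add_eq_0_iff)
  then have "card {t. t * g + h \<noteq> 0} = CARD('f) - 1" by (simp add: card_Diff_subset)
  then show ?thesis using False by (simp add: of_nat_diff Suc_leI)
qed

text \<open>
  Unless both coefficients of \<open>t\<close> vanish, the two equations have a common solution exactly when
  their resultant is zero, and it is then unique.
\<close>

lemma card_affine_pair_nonzero:
  fixes g1 h1 g2 h2 :: "'f::{field,finite}"
  shows "int (card {t. \<not> (t * g1 + h1 = 0 \<and> t * g2 + h2 = 0)}) =
    int CARD('f) * of_bool (\<not> (g1 = 0 \<and> g2 = 0 \<and> h1 = 0 \<and> h2 = 0))
      - of_bool (\<not> (g1 = 0 \<and> g2 = 0)) + of_bool (g1 * h2 - h1 * g2 \<noteq> 0)"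
proof (cases "g1 = 0 \<and> g2 = 0")
  case True
  then show ?thesis by (cases "h1 = 0 \<and> h2 = 0") auto
next
  case False
  define s where "s = (if g1 \<noteq> 0 then - h1 / g1 else - h2 / g2)"
  have sol: "t * g1 + h1 = 0 \<and> t * g2 + h2 = 0 \<longleftrightarrow> t = s \<and> g1 * h2 - h1 * g2 = 0" for t
  proof (cases "g1 = 0")
    case True
    then have "g2 \<noteq> 0" using False by simp
    then show ?thesis unfolding s_def using True by (auto simp: field_simps add_eq_0_iff)
  next
    case g1: False
    then have "t * g1 + h1 = 0 \<longleftrightarrow> t = s" unfolding s_def by (auto simp: field_simps add_eq_0_iff)
    moreover have "g1 * (s * g2 + h2) = g1 * h2 - h1 * g2"
      unfolding s_def using g1 by (simp add: field_simps)
    then have "s * g2 + h2 = 0 \<longleftrightarrow> g1 * h2 - h1 * g2 = 0" using g1 by (metis mult_eq_0_iff)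
    ultimately show ?thesis by blast
  qed
  have "{t. \<not> (t * g1 + h1 = 0 \<and> t * g2 + h2 = 0)} =
      (if g1 * h2 - h1 * g2 = 0 then UNIV - {s} else UNIV)"
    unfolding sol by auto
  moreover have "int (CARD('f) - 1) = int CARD('f) - 1" by (simp add: of_nat_diff Suc_leI)
  ultimately show ?thesis using False by (auto simp: card_Diff_subset)
qed

lemma finite_points: "finite E \<Longrightarrow> finite (E \<rightarrow>\<^sub>E (UNIV :: 'f::finite set))"
  by (rule finite_PiE) auto

lemma sum_of_bool_card:
  "finite A \<Longrightarrow> (\<Sum>\<beta>\<in>A. of_bool (P \<beta>) :: int) = int (card {\<beta> \<in> A. P \<beta>})"
  by (simp add: sum_of_bool_eq Int_def)

text \<open>
  For a polynomial \<open>t * g + h\<close> in which \<open>g\<close> and \<open>h\<close> do not contain \<open>t\<close>, the number of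
  nonzeros is minus that of \<open>g\<close> modulo \<open>q\<close>. Here \<open>{}\<close> is excluded since its summand is the product of
  all variables; this property passes to \<open>g\<close>.
\<close>

lemma warning_multilinear:
  fixes E :: "'e set"
  assumes "finite E" and "\<F> \<subseteq> Pow E" and "{} \<notin> \<F>"
  shows "int CARD('f) dvd
    int (card {\<alpha> \<in> E \<rightarrow>\<^sub>E (UNIV :: 'f::{field,finite} set). compl_poly \<F> E \<alpha> \<noteq> 0})"
  using assms
proof (induction E arbitrary: \<F> rule: finite_induct)
  case empty
  then have "\<F> = {}" by auto
  then show ?case by simp
next
  case (insert e E)
  let ?S = "E \<rightarrow>\<^sub>E (UNIV :: 'f set)"
  define \<A> where "\<A> = {F \<in> \<F>. e \<notin> F}"
  define \<B> where "\<B> = (\<lambda>F. F - {e}) ` {F \<in> \<F>. e \<in> F}"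
  have \<A>: "\<A> \<subseteq> Pow E" "{} \<notin> \<A>" unfolding \<A>_def using insert.prems by auto
  have \<B>: "\<B> \<subseteq> Pow E" unfolding \<B>_def using insert.prems by auto
  have "\<F> = \<A> \<union> insert e ` \<B>"
    unfolding \<A>_def \<B>_def by (auto simp: image_iff insert_absorb)
  then have split: "compl_poly \<F> (insert e E) \<alpha> = \<alpha> e * compl_poly \<A> E \<alpha> + compl_poly \<B> E \<alpha>" for \<alpha> :: "'e \<Rightarrow> 'f"
    using compl_poly_split[of "insert e E" e \<A> \<B> \<alpha>] insert.hyps \<A> \<B> by simp
  have upd: "compl_poly \<G> E (\<beta>(e := t)) = compl_poly \<G> E \<beta>" for \<G> and \<beta> :: "'e \<Rightarrow> 'f" and t
    by (rule compl_poly_cong) (use insert.hyps in auto)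
  have "int (card {\<alpha> \<in> insert e E \<rightarrow>\<^sub>E (UNIV :: 'f set). compl_poly \<F> (insert e E) \<alpha> \<noteq> 0}) =
      (\<Sum>\<beta>\<in>?S. int (card {t. t * compl_poly \<A> E \<beta> + compl_poly \<B> E \<beta> \<noteq> 0}))"
    by (subst card_PiE_insert[OF insert.hyps]) (simp add: split upd)
  also have "\<dots> = int CARD('f) * (\<Sum>\<beta>\<in>?S. of_bool (\<not> (compl_poly \<A> E \<beta> = 0 \<and> compl_poly \<B> E \<beta> = 0)))
      - int (card {\<beta> \<in> ?S. compl_poly \<A> E \<beta> \<noteq> 0})"
    unfolding card_affine_nonzero sum_subtractf sum_distrib_left
    by (subst sum_of_bool_card[OF finite_points[OF insert.hyps(1)]]) (rule refl)
  also have "int CARD('f) dvd \<dots>"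
    using insert.IH[OF \<A>] by (intro dvd_diff) auto
  finally show ?case .
qed

lemma warning_forests:
  fixes nd :: "'e \<Rightarrow> 'v set"
  assumes "edges_in nd V E" and "\<not> V \<subseteq> R"
  shows "int CARD('f) dvd
    int (card {\<alpha> \<in> E \<rightarrow>\<^sub>E (UNIV :: 'f::{field,finite} set). compl_poly (forests nd V E R) E \<alpha> \<noteq> 0})"
proof (rule warning_multilinear)
  show "finite E" using assms(1) unfolding edges_in_def by simp
  show "forests nd V E R \<subseteq> Pow E" by (rule forests_Pow)
  have "finite V" using assms(1) unfolding edges_in_def by simp
  then have "card (V - R) \<noteq> 0" using assms(2) by simp
  then show "{} \<notin> forests nd V E R" unfolding forests_def by auto
qed

lemma warning_linking:
  fixes nd :: "'e \<Rightarrow> 'v set"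
  assumes "edges_in nd V E" and "p \<noteq> v"
  shows "int CARD('f) dvd
    int (card {\<alpha> \<in> E \<rightarrow>\<^sub>E (UNIV :: 'f::{field,finite} set). compl_poly (linking nd V E R p v) E \<alpha> \<noteq> 0})"
proof (rule warning_multilinear)
  show "finite E" using assms(1) unfolding edges_in_def by simp
  show "linking nd V E R p v \<subseteq> Pow E" by (rule linking_Pow)
  show "{} \<notin> linking nd V E R p v" using assms(2) unfolding linking_def link_def by auto
qed

text \<open>
  Elimination of the variable \<open>e\<close> from two equations whose resultant is minus the square of \<open>D\<close>.
  The square does not matter for the vanishing, so only the number of nonzeros of \<open>D\<close> enters.
\<close>

lemma pair_nonzero_recursion:
  fixes E :: "'e set" and g1 h1 g2 h2 :: "('e \<Rightarrow> 'f::{field,finite}) \<Rightarrow> 'f"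
  assumes "finite E" and "e \<in> E"
    and f1: "\<And>\<alpha>. f1 \<alpha> = \<alpha> e * g1 \<alpha> + h1 \<alpha>" and f2: "\<And>\<alpha>. f2 \<alpha> = \<alpha> e * g2 \<alpha> + h2 \<alpha>"
    and upd: "\<And>\<alpha> t. g1 (\<alpha>(e := t)) = g1 \<alpha>" "\<And>\<alpha> t. h1 (\<alpha>(e := t)) = h1 \<alpha>"
      "\<And>\<alpha> t. g2 (\<alpha>(e := t)) = g2 \<alpha>" "\<And>\<alpha> t. h2 (\<alpha>(e := t)) = h2 \<alpha>"
    and res: "\<And>\<alpha>. g1 \<alpha> * h2 \<alpha> - h1 \<alpha> * g2 \<alpha> = - (D \<alpha>)\<^sup>2"
    and g: "int CARD('f) dvd int (card {\<beta> \<in> (E - {e}) \<rightarrow>\<^sub>E UNIV. \<not> (g1 \<beta> = 0 \<and> g2 \<beta> = 0)})"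
    and D: "int CARD('f) dvd int (card {\<beta> \<in> (E - {e}) \<rightarrow>\<^sub>E UNIV. D \<beta> \<noteq> 0})"
  shows "int CARD('f) dvd int (card {\<alpha> \<in> E \<rightarrow>\<^sub>E UNIV. \<not> (f1 \<alpha> = 0 \<and> f2 \<alpha> = 0)})"
proof -
  let ?S = "(E - {e}) \<rightarrow>\<^sub>E (UNIV :: 'f set)"
  have fin: "finite (E - {e})" using assms(1) by simp
  have ins: "insert e (E - {e}) = E" using assms(2) by blast
  have res': "g1 \<beta> * h2 \<beta> - h1 \<beta> * g2 \<beta> \<noteq> 0 \<longleftrightarrow> D \<beta> \<noteq> 0" for \<beta> unfolding res by simp
  have "card {\<alpha> \<in> insert e (E - {e}) \<rightarrow>\<^sub>E UNIV. \<not> (f1 \<alpha> = 0 \<and> f2 \<alpha> = 0)} =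
      (\<Sum>\<beta>\<in>?S. card {t. \<not> (f1 (\<beta>(e := t)) = 0 \<and> f2 (\<beta>(e := t)) = 0)})"
    by (rule card_PiE_insert[OF fin]) simp
  then have "int (card {\<alpha> \<in> E \<rightarrow>\<^sub>E UNIV. \<not> (f1 \<alpha> = 0 \<and> f2 \<alpha> = 0)}) =
      (\<Sum>\<beta>\<in>?S. int (card {t. \<not> (t * g1 \<beta> + h1 \<beta> = 0 \<and> t * g2 \<beta> + h2 \<beta> = 0)}))"
    unfolding ins f1 f2 upd by simp
  also have "\<dots> = int CARD('f) * (\<Sum>\<beta>\<in>?S. of_bool (\<not> (g1 \<beta> = 0 \<and> g2 \<beta> = 0 \<and> h1 \<beta> = 0 \<and> h2 \<beta> = 0)))
      - int (card {\<beta> \<in> ?S. \<not> (g1 \<beta> = 0 \<and> g2 \<beta> = 0)}) + int (card {\<beta> \<in> ?S. D \<beta> \<noteq> 0})"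
    unfolding card_affine_pair_nonzero res' sum_subtractf sum.distrib
      sum_of_bool_card[OF finite_points[OF fin], symmetric] sum_distrib_left ..
  also have "int CARD('f) dvd \<dots>" using g D by (intro dvd_add dvd_diff) auto
  finally show ?thesis .
qed

text \<open>
  Remove an edge from \<open>R\<close> to a vertex \<open>c\<close>. For \<open>c = b\<close> the resultant is visibly minus a square; for
  other \<open>c\<close> it is the expression in \<open>dodgson_forests\<close> for the vertices \<open>c\<close> and \<open>b\<close>.
\<close>

lemma two_roots_nonzero_count:
  fixes nd :: "'e \<Rightarrow> 'v set"
  assumes "edges_in nd V E" and "R \<subseteq> V" and "b \<in> V - R" and "\<not> V \<subseteq> insert b R"
  shows "int CARD('f) dvd int (card {\<alpha> \<in> E \<rightarrow>\<^sub>E (UNIV :: 'f::{field,finite} set).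
    \<not> (compl_poly (forests nd V E R) E \<alpha> = 0 \<and> compl_poly (forests nd V E (insert b R)) E \<alpha> = 0)})"
  using assms(1)
proof (induction "card E" arbitrary: E rule: less_induct)
  case less
  note E = less.prems
  have fin: "finite V" "finite E" using E unfolding edges_in_def by auto
  have RV: "insert b R \<subseteq> V" using assms(2,3) by blast
  show ?case
  proof (cases "\<exists>e\<in>E. \<exists>a\<in>R. \<exists>c\<in>V - R. nd e = {a, c}")
    case False
    have "forests nd V E R = {}" by (rule forests_empty[OF E]) (use False assms(4) in auto)
    then show ?thesis using warning_forests[OF E assms(4), where 'f = 'f] by simp
  next
    case True
    then obtain e a c where e: "e \<in> E" "a \<in> R" "c \<in> V - R" "nd e = {a, c}" by blast
    let ?E = "E - {e}"
    have E': "edges_in nd V ?E" using edges_in_mono[OF E] by blast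
    have lt: "card ?E < card E" using fin e(1) by (intro card_Diff1_less)
    have upd: "compl_poly \<G> ?E (\<beta>(e := t)) = compl_poly \<G> ?E \<beta>" for \<G> and \<beta> :: "'e \<Rightarrow> 'f" and t
      by (rule compl_poly_cong) auto
    have cR: "c \<notin> R" using e by blast
    note split1 = compl_poly_forests_split[OF E e(1,4,2) cR]
    show ?thesis
    proof (cases "c = b")
      case True
      have ab: "a \<noteq> c" using e by blast
      have split2: "compl_poly (forests nd V E (insert b R)) E \<alpha> =
          \<alpha> e * compl_poly (forests nd V ?E (insert b R)) ?E \<alpha> + 0" for \<alpha> :: "'e \<Rightarrow> 'f"
        using compl_poly_forests_inside[OF E RV e(1,4) _ _ ab] e(2) True by simp
      show ?thesis
      proof (rule pair_nonzero_recursion[where ?g1.0 = "compl_poly (forests nd V ?E R) ?E"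
              and ?h1.0 = "compl_poly (forests nd V ?E (insert b R)) ?E"
              and ?g2.0 = "compl_poly (forests nd V ?E (insert b R)) ?E" and ?h2.0 = "\<lambda>\<alpha>. 0"
              and D = "compl_poly (forests nd V ?E (insert b R)) ?E"])
        show "int CARD('f) dvd int (card {\<beta> \<in> ?E \<rightarrow>\<^sub>E (UNIV :: 'f set).
            \<not> (compl_poly (forests nd V ?E R) ?E \<beta> = 0 \<and> compl_poly (forests nd V ?E (insert b R)) ?E \<beta> = 0)})"
          by (rule less.hyps[OF lt E'])
        show "int CARD('f) dvd int (card {\<beta> \<in> ?E \<rightarrow>\<^sub>E (UNIV :: 'f set).
            compl_poly (forests nd V ?E (insert b R)) ?E \<beta> \<noteq> 0})"
          by (rule warning_forests[OF E' assms(4)])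
      qed (use fin(2) e(1) upd split2 in \<open>simp_all add: split1[unfolded True] power2_eq_square\<close>)
    next
      case False
      then have cb: "c \<notin> insert b R" using cR by simp
      note split2 = compl_poly_forests_split[OF E e(1,4) insertI2[OF e(2)] cb]
      have res: "compl_poly (forests nd V ?E R) ?E \<alpha> * compl_poly (forests nd V ?E (insert c (insert b R))) ?E \<alpha>
          - compl_poly (forests nd V ?E (insert c R)) ?E \<alpha> * compl_poly (forests nd V ?E (insert b R)) ?E \<alpha>
          = - (compl_poly (linking nd V ?E R c b) ?E \<alpha>)\<^sup>2" for \<alpha> :: "'e \<Rightarrow> 'f"
        using dodgson_forests[OF E' assms(2) e(3) assms(3) False, of \<alpha>] by simp
      show ?thesis
        by (rule pair_nonzero_recursion[where ?g1.0 = "compl_poly (forests nd V ?E R) ?E"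
              and ?h1.0 = "compl_poly (forests nd V ?E (insert c R)) ?E"
              and ?g2.0 = "compl_poly (forests nd V ?E (insert b R)) ?E"
              and ?h2.0 = "compl_poly (forests nd V ?E (insert c (insert b R))) ?E",
              OF fin(2) e(1) split1 split2 upd upd upd upd res
              less.hyps[OF lt E'] warning_linking[OF E' False]])
    qed
  qed
qed

text \<open>
  The number of nonzeros of \<open>t * g + h\<close> is \<open>q\<close> times the number of points where
  \<open>g\<close> and \<open>h\<close> are not both zero, minus the number of nonzeros of \<open>g\<close>. The first is divisible by
  \<open>q\<^sup>2\<close> by \<open>two_roots_nonzero_count\<close>, the second by induction.
\<close>

lemma forests_nonzero_count_square:
  fixes nd :: "'e \<Rightarrow> 'v set"
  assumes "edges_in nd V E" and "R \<subseteq> V" and "card (V - R) \<ge> 2"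
  shows "(int CARD('f))\<^sup>2 dvd int (card {\<alpha> \<in> E \<rightarrow>\<^sub>E (UNIV :: 'f::{field,finite} set).
    compl_poly (forests nd V E R) E \<alpha> \<noteq> 0})"
  using assms(1)
proof (induction "card E" arbitrary: E rule: less_induct)
  case less
  note E = less.prems
  have fin: "finite V" "finite E" using E unfolding edges_in_def by auto
  have big: "\<not> V \<subseteq> insert b R" for b
  proof
    assume "V \<subseteq> insert b R"
    then have "V - R \<subseteq> {b}" by blast
    then have "card (V - R) \<le> 1" using card_mono[of "{b}" "V - R"] by simp
    then show False using assms(3) by simp
  qed
  show ?case
  proof (cases "\<exists>e\<in>E. \<exists>a\<in>R. \<exists>b\<in>V - R. nd e = {a, b}")
    case False
    have nVR: "\<not> V \<subseteq> R" using big by blast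
    have "forests nd V E R = {}" by (rule forests_empty[OF E nVR]) (use False in auto)
    then show ?thesis by simp
  next
    case True
    then obtain e a b where e: "e \<in> E" "a \<in> R" "b \<in> V - R" "nd e = {a, b}" by blast
    let ?E = "E - {e}"
    let ?S = "?E \<rightarrow>\<^sub>E (UNIV :: 'f set)"
    let ?g = "compl_poly (forests nd V ?E R) ?E" and ?h = "compl_poly (forests nd V ?E (insert b R)) ?E"
    have E': "edges_in nd V ?E" using edges_in_mono[OF E] by blast
    have lt: "card ?E < card E" using fin e(1) by (intro card_Diff1_less)
    have finE': "finite ?E" using fin by simp
    have ins: "insert e ?E = E" using e(1) by blast
    have upd: "compl_poly \<G> ?E (\<beta>(e := t)) = compl_poly \<G> ?E \<beta>" for \<G> and \<beta> :: "'e \<Rightarrow> 'f" and t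
      by (rule compl_poly_cong) auto
    have bR: "b \<notin> R" using e by blast
    note split = compl_poly_forests_split[OF E e(1,4,2) bR]
    have "card {\<alpha> \<in> insert e ?E \<rightarrow>\<^sub>E (UNIV :: 'f set). compl_poly (forests nd V E R) E \<alpha> \<noteq> 0} =
        (\<Sum>\<beta>\<in>?S. card {t. compl_poly (forests nd V E R) E (\<beta>(e := t)) \<noteq> 0})"
      by (rule card_PiE_insert[OF finE']) simp
    then have "int (card {\<alpha> \<in> E \<rightarrow>\<^sub>E (UNIV :: 'f set). compl_poly (forests nd V E R) E \<alpha> \<noteq> 0}) =
        (\<Sum>\<beta>\<in>?S. int (card {t. t * ?g \<beta> + ?h \<beta> \<noteq> 0}))"
      unfolding ins split upd by simp
    also have "\<dots> = int CARD('f) * int (card {\<beta> \<in> ?S. \<not> (?g \<beta> = 0 \<and> ?h \<beta> = 0)})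
        - int (card {\<beta> \<in> ?S. ?g \<beta> \<noteq> 0})"
      unfolding card_affine_nonzero sum_subtractf
        sum_of_bool_card[OF finite_points[OF finE'], symmetric] sum_distrib_left ..
    also have "(int CARD('f))\<^sup>2 dvd \<dots>"
    proof (rule dvd_diff)
      show "(int CARD('f))\<^sup>2 dvd int CARD('f) * int (card {\<beta> \<in> ?S. \<not> (?g \<beta> = 0 \<and> ?h \<beta> = 0)})"
        unfolding power2_eq_square
        by (rule mult_dvd_mono[OF dvd_refl two_roots_nonzero_count[OF E' assms(2) e(3) big]])
      show "(int CARD('f))\<^sup>2 dvd int (card {\<beta> \<in> ?S. ?g \<beta> \<noteq> 0})"
        by (rule less.hyps[OF lt E'])
    qed
    finally show ?thesis .
  qed
qed

section \<open>Gluing along two vertices\<close>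

text \<open>
  When all common vertices are roots, a forest is a pair of independent forests on the two sides.
  The proof removes edges from roots to new vertices, which lie on one side each.
\<close>

lemma forests_glue_product:
  fixes nd :: "'e \<Rightarrow> 'v set" and \<alpha> :: "'e \<Rightarrow> 'a::comm_ring_1"
  assumes "edges_in nd V1 E1" and "edges_in nd V2 E2" and "E1 \<inter> E2 = {}"
    and "R \<subseteq> V1 \<union> V2" and "V1 \<inter> V2 \<subseteq> R"
  shows "compl_poly (forests nd (V1 \<union> V2) (E1 \<union> E2) R) (E1 \<union> E2) \<alpha> =
    compl_poly (forests nd V1 E1 (R \<inter> V1)) E1 \<alpha> * compl_poly (forests nd V2 E2 (R \<inter> V2)) E2 \<alpha>"
  using assms
proof (induction "card (E1 \<union> E2)" arbitrary: E1 E2 R rule: less_induct)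
  case less
  have step: "compl_poly (forests nd (W1 \<union> W2) (D1 \<union> D2) R) (D1 \<union> D2) \<alpha> =
      compl_poly (forests nd W1 D1 (R \<inter> W1)) D1 \<alpha> * compl_poly (forests nd W2 D2 (R \<inter> W2)) D2 \<alpha>"
    if D1: "edges_in nd W1 D1" and D2: "edges_in nd W2 D2" and disj: "D1 \<inter> D2 = {}"
      and RW: "R \<subseteq> W1 \<union> W2" and WR: "W1 \<inter> W2 \<subseteq> R"
      and IH: "\<And>R. R \<subseteq> W1 \<union> W2 \<Longrightarrow> W1 \<inter> W2 \<subseteq> R \<Longrightarrow>
        compl_poly (forests nd (W1 \<union> W2) ((D1 - {e}) \<union> D2) R) ((D1 - {e}) \<union> D2) \<alpha> =
        compl_poly (forests nd W1 (D1 - {e}) (R \<inter> W1)) (D1 - {e}) \<alpha> * compl_poly (forests nd W2 D2 (R \<inter> W2)) D2 \<alpha>"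
      and e: "e \<in> D1" "a \<in> R" "b \<notin> R" "nd e = {a, b}"
    for W1 W2 D1 D2 e a b
  proof -
    have ab: "a \<in> W1" "b \<in> W1" using edges_in_ends[OF D1 e(1,4)] by auto
    have bW2: "b \<notin> W2" using ab e(3) WR by blast
    have D: "edges_in nd (W1 \<union> W2) (D1 \<union> D2)" using D1 D2 unfolding edges_in_def by blast
    have De: "(D1 \<union> D2) - {e} = (D1 - {e}) \<union> D2" using e(1) disj by blast
    have bR: "insert b R \<inter> W1 = insert b (R \<inter> W1)" "insert b R \<inter> W2 = R \<inter> W2"
      using ab bW2 by auto
    have IH1: "compl_poly (forests nd (W1 \<union> W2) ((D1 - {e}) \<union> D2) (insert b R)) ((D1 - {e}) \<union> D2) \<alpha> =
        compl_poly (forests nd W1 (D1 - {e}) (insert b (R \<inter> W1))) (D1 - {e}) \<alpha> *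
        compl_poly (forests nd W2 D2 (R \<inter> W2)) D2 \<alpha>"
      using IH[of "insert b R"] RW WR ab unfolding bR by blast
    have "compl_poly (forests nd W1 D1 (R \<inter> W1)) D1 \<alpha> =
        \<alpha> e * compl_poly (forests nd W1 (D1 - {e}) (R \<inter> W1)) (D1 - {e}) \<alpha>
        + compl_poly (forests nd W1 (D1 - {e}) (insert b (R \<inter> W1))) (D1 - {e}) \<alpha>"
      by (rule compl_poly_forests_split[OF D1 e(1,4)]) (use e ab in auto)
    moreover have "compl_poly (forests nd (W1 \<union> W2) (D1 \<union> D2) R) (D1 \<union> D2) \<alpha> =
        \<alpha> e * compl_poly (forests nd (W1 \<union> W2) (D1 - {e} \<union> D2) R) (D1 - {e} \<union> D2) \<alpha>
        + compl_poly (forests nd (W1 \<union> W2) (D1 - {e} \<union> D2) (insert b R)) (D1 - {e} \<union> D2) \<alpha>"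
      unfolding De[symmetric] by (rule compl_poly_forests_split[OF D _ e(4,2,3)]) (use e in simp)
    ultimately show ?thesis
      unfolding IH[OF RW WR] IH1 by (simp add: algebra_simps)
  qed
  note E1 = less.prems(1) and E2 = less.prems(2) and disj = less.prems(3)
    and RV = less.prems(4) and VR = less.prems(5)
  let ?V = "V1 \<union> V2" and ?E = "E1 \<union> E2"
  have fin: "finite E1" "finite E2" using E1 E2 unfolding edges_in_def by auto
  have E: "edges_in nd ?V ?E" using E1 E2 unfolding edges_in_def by blast
  show ?case
  proof (cases "\<exists>e\<in>?E. \<exists>a\<in>R. \<exists>b\<in>?V - R. nd e = {a, b}")
    case True
    then obtain e a b where e: "e \<in> ?E" "a \<in> R" "b \<in> ?V - R" "nd e = {a, b}" by blast
    then have bR: "b \<notin> R" by blast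
    have lt: "card (?E - {e}) < card ?E" using fin e(1) by (intro card_Diff1_less) auto
    show ?thesis
    proof (cases "e \<in> E1")
      case True
      then have "?E - {e} = (E1 - {e}) \<union> E2" using disj by blast
      then have lt1: "card ((E1 - {e}) \<union> E2) < card ?E" using lt by simp
      have E1': "edges_in nd V1 (E1 - {e})" using edges_in_mono[OF E1] by blast
      have disj': "(E1 - {e}) \<inter> E2 = {}" using disj by blast
      show ?thesis
        by (rule step[OF E1 E2 disj RV VR less.hyps[OF lt1 E1' E2 disj'] True e(2) bR e(4)])
    next
      case False
      then have eE2: "e \<in> E2" using e by blast
      then have "?E - {e} = E1 \<union> (E2 - {e})" using disj by blast
      then have lt2: "card (E1 \<union> (E2 - {e})) < card ?E" using lt by simp
      have E2': "edges_in nd V2 (E2 - {e})" using edges_in_mono[OF E2] by blast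
      have disj': "E1 \<inter> (E2 - {e}) = {}" using disj by blast
      have "compl_poly (forests nd (V2 \<union> V1) (E2 \<union> E1) R) (E2 \<union> E1) \<alpha> =
          compl_poly (forests nd V2 E2 (R \<inter> V2)) E2 \<alpha> * compl_poly (forests nd V1 E1 (R \<inter> V1)) E1 \<alpha>"
      proof (rule step[OF E2 E1 _ _ _ _ eE2 e(2) bR e(4)])
        fix R assume R: "R \<subseteq> V2 \<union> V1" "V2 \<inter> V1 \<subseteq> R"
        show "compl_poly (forests nd (V2 \<union> V1) ((E2 - {e}) \<union> E1) R) ((E2 - {e}) \<union> E1) \<alpha> =
          compl_poly (forests nd V2 (E2 - {e}) (R \<inter> V2)) (E2 - {e}) \<alpha> *
          compl_poly (forests nd V1 E1 (R \<inter> V1)) E1 \<alpha>"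
          using less.hyps[OF lt2 E1 E2' disj', of R] R by (simp add: Un_commute Int_commute mult.commute)
      qed (use disj RV VR in auto)
      then show ?thesis by (simp add: Un_commute mult.commute)
    qed
  next
    case False
    show ?thesis
    proof (cases "?V \<subseteq> R")
      case True
      then have R: "V1 \<subseteq> R \<inter> V1" "V2 \<subseteq> R \<inter> V2" by auto
      have "finite ?E" using fin by simp
      then show ?thesis
        unfolding forests_all[OF True \<open>finite ?E\<close>] forests_all[OF R(1) fin(1)] forests_all[OF R(2) fin(2)]
        by (simp add: compl_poly_def prod.union_disjoint[OF fin disj])
    next
      case notall: False
      have "forests nd ?V ?E R = {}" by (rule forests_empty[OF E notall]) (use False in auto)
      moreover have "forests nd V1 E1 (R \<inter> V1) = {} \<or> forests nd V2 E2 (R \<inter> V2) = {}"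
      proof (cases "V1 \<subseteq> R \<inter> V1")
        case True
        then have nV2: "\<not> V2 \<subseteq> R \<inter> V2" using notall by blast
        have "forests nd V2 E2 (R \<inter> V2) = {}"
          by (rule forests_empty[OF E2 nV2]) (use False in auto)
        then show ?thesis ..
      next
        case nV1: False
        have "forests nd V1 E1 (R \<inter> V1) = {}"
          by (rule forests_empty[OF E1 nV1]) (use False in auto)
        then show ?thesis ..
      qed
      ultimately show ?thesis by auto
    qed
  qed
qed

text \<open>
  Here \<open>v\<close> is the only common vertex that is not a root, and exactly one side connects it to \<open>R\<close>;
  for the other side \<open>v\<close> acts as a further root. The case \<open>b = v\<close> of the induction ends in
  \<open>forests_glue_product\<close>.
\<close>

lemma forests_glue_two:
  fixes nd :: "'e \<Rightarrow> 'v set" and \<alpha> :: "'e \<Rightarrow> 'a::comm_ring_1"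
  assumes "edges_in nd V1 E1" and "edges_in nd V2 E2" and "E1 \<inter> E2 = {}"
    and "R \<subseteq> V1 \<union> V2" and "V1 \<inter> V2 \<subseteq> insert v R" and "v \<in> V1 \<inter> V2" and "v \<notin> R"
  shows "compl_poly (forests nd (V1 \<union> V2) (E1 \<union> E2) R) (E1 \<union> E2) \<alpha> =
    compl_poly (forests nd V1 E1 (R \<inter> V1)) E1 \<alpha> * compl_poly (forests nd V2 E2 (insert v (R \<inter> V2))) E2 \<alpha>
    + compl_poly (forests nd V1 E1 (insert v (R \<inter> V1))) E1 \<alpha> * compl_poly (forests nd V2 E2 (R \<inter> V2)) E2 \<alpha>"
  using assms
proof (induction "card (E1 \<union> E2)" arbitrary: E1 E2 R rule: less_induct)
  case less
  have step: "compl_poly (forests nd (W1 \<union> W2) (D1 \<union> D2) R) (D1 \<union> D2) \<alpha> =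
      compl_poly (forests nd W1 D1 (R \<inter> W1)) D1 \<alpha> * compl_poly (forests nd W2 D2 (insert v (R \<inter> W2))) D2 \<alpha>
      + compl_poly (forests nd W1 D1 (insert v (R \<inter> W1))) D1 \<alpha> * compl_poly (forests nd W2 D2 (R \<inter> W2)) D2 \<alpha>"
    if D1: "edges_in nd W1 D1" and D2: "edges_in nd W2 D2" and disj: "D1 \<inter> D2 = {}"
      and RW: "R \<subseteq> W1 \<union> W2" and WR: "W1 \<inter> W2 \<subseteq> insert v R"
      and vW: "v \<in> W1 \<inter> W2" and vR: "v \<notin> R"
      and IH: "\<And>R. R \<subseteq> W1 \<union> W2 \<Longrightarrow> W1 \<inter> W2 \<subseteq> insert v R \<Longrightarrow> v \<notin> R \<Longrightarrow>
        compl_poly (forests nd (W1 \<union> W2) ((D1 - {e}) \<union> D2) R) ((D1 - {e}) \<union> D2) \<alpha> =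
        compl_poly (forests nd W1 (D1 - {e}) (R \<inter> W1)) (D1 - {e}) \<alpha> * compl_poly (forests nd W2 D2 (insert v (R \<inter> W2))) D2 \<alpha>
        + compl_poly (forests nd W1 (D1 - {e}) (insert v (R \<inter> W1))) (D1 - {e}) \<alpha> * compl_poly (forests nd W2 D2 (R \<inter> W2)) D2 \<alpha>"
      and e: "e \<in> D1" "a \<in> R" "b \<notin> R" "nd e = {a, b}"
    for W1 W2 D1 D2 e a b
  proof -
    have ab: "a \<in> W1" "b \<in> W1" using edges_in_ends[OF D1 e(1,4)] by auto
    have D: "edges_in nd (W1 \<union> W2) (D1 \<union> D2)" using D1 D2 unfolding edges_in_def by blast
    have De: "(D1 \<union> D2) - {e} = (D1 - {e}) \<union> D2" using e(1) disj by blast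
    have D1': "edges_in nd W1 (D1 - {e})" using edges_in_mono[OF D1] by blast
    have disj': "(D1 - {e}) \<inter> D2 = {}" using disj by blast
    have split: "compl_poly (forests nd (W1 \<union> W2) (D1 \<union> D2) R) (D1 \<union> D2) \<alpha> =
        \<alpha> e * compl_poly (forests nd (W1 \<union> W2) (D1 - {e} \<union> D2) R) (D1 - {e} \<union> D2) \<alpha>
        + compl_poly (forests nd (W1 \<union> W2) (D1 - {e} \<union> D2) (insert b R)) (D1 - {e} \<union> D2) \<alpha>"
      unfolding De[symmetric] by (rule compl_poly_forests_split[OF D _ e(4,2,3)]) (use e in simp)
    have split1: "compl_poly (forests nd W1 D1 (R \<inter> W1)) D1 \<alpha> =
        \<alpha> e * compl_poly (forests nd W1 (D1 - {e}) (R \<inter> W1)) (D1 - {e}) \<alpha>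
        + compl_poly (forests nd W1 (D1 - {e}) (insert b (R \<inter> W1))) (D1 - {e}) \<alpha>"
      by (rule compl_poly_forests_split[OF D1 e(1,4)]) (use e ab in auto)
    show ?thesis
    proof (cases "b = v")
      case True
      have int: "insert v R \<inter> W1 = insert v (R \<inter> W1)" "insert v R \<inter> W2 = insert v (R \<inter> W2)"
        using vW by auto
      have glue: "compl_poly (forests nd (W1 \<union> W2) (D1 - {e} \<union> D2) (insert v R)) (D1 - {e} \<union> D2) \<alpha> =
          compl_poly (forests nd W1 (D1 - {e}) (insert v (R \<inter> W1))) (D1 - {e}) \<alpha> *
          compl_poly (forests nd W2 D2 (insert v (R \<inter> W2))) D2 \<alpha>"
        using forests_glue_product[OF D1' D2 disj', of "insert v R" \<alpha>] RW WR vW unfolding int by blast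
      have "compl_poly (forests nd W1 D1 (insert v (R \<inter> W1))) D1 \<alpha> =
          \<alpha> e * compl_poly (forests nd W1 (D1 - {e}) (insert v (R \<inter> W1))) (D1 - {e}) \<alpha>"
        by (rule compl_poly_forests_inside[OF D1 _ e(1,4)]) (use e ab True vR vW in auto)
      then show ?thesis
        unfolding split split1 True IH[OF RW WR vR] glue by (simp add: algebra_simps)
    next
      case False
      have bW2: "b \<notin> W2" using ab e(3) WR False by blast
      have bR: "insert b R \<inter> W1 = insert b (R \<inter> W1)" "insert b R \<inter> W2 = R \<inter> W2"
        using ab bW2 by auto
      have IH1: "compl_poly (forests nd (W1 \<union> W2) ((D1 - {e}) \<union> D2) (insert b R)) ((D1 - {e}) \<union> D2) \<alpha> =
          compl_poly (forests nd W1 (D1 - {e}) (insert b (R \<inter> W1))) (D1 - {e}) \<alpha> *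
          compl_poly (forests nd W2 D2 (insert v (R \<inter> W2))) D2 \<alpha>
          + compl_poly (forests nd W1 (D1 - {e}) (insert v (insert b (R \<inter> W1)))) (D1 - {e}) \<alpha> *
          compl_poly (forests nd W2 D2 (R \<inter> W2)) D2 \<alpha>"
        using IH[of "insert b R"] RW WR ab False vR unfolding bR by blast
      have "compl_poly (forests nd W1 D1 (insert v (R \<inter> W1))) D1 \<alpha> =
          \<alpha> e * compl_poly (forests nd W1 (D1 - {e}) (insert v (R \<inter> W1))) (D1 - {e}) \<alpha>
          + compl_poly (forests nd W1 (D1 - {e}) (insert b (insert v (R \<inter> W1)))) (D1 - {e}) \<alpha>"
        by (rule compl_poly_forests_split[OF D1 e(1,4)]) (use e ab False in auto)
      then show ?thesis
        unfolding split split1 IH[OF RW WR vR] IH1 insert_commute[of b v] by (simp add: algebra_simps)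
    qed
  qed
  note E1 = less.prems(1) and E2 = less.prems(2) and disj = less.prems(3)
    and RV = less.prems(4) and VR = less.prems(5) and vV = less.prems(6) and vR = less.prems(7)
  let ?V = "V1 \<union> V2" and ?E = "E1 \<union> E2"
  have fin: "finite E1" "finite E2" using E1 E2 unfolding edges_in_def by auto
  have E: "edges_in nd ?V ?E" using E1 E2 unfolding edges_in_def by blast
  show ?case
  proof (cases "\<exists>e\<in>?E. \<exists>a\<in>R. \<exists>b\<in>?V - R. nd e = {a, b}")
    case True
    then obtain e a b where e: "e \<in> ?E" "a \<in> R" "b \<in> ?V - R" "nd e = {a, b}" by blast
    then have bR: "b \<notin> R" by blast
    have lt: "card (?E - {e}) < card ?E" using fin e(1) by (intro card_Diff1_less) auto
    show ?thesis
    proof (cases "e \<in> E1")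
      case True
      then have "?E - {e} = (E1 - {e}) \<union> E2" using disj by blast
      then have lt1: "card ((E1 - {e}) \<union> E2) < card ?E" using lt by simp
      have E1': "edges_in nd V1 (E1 - {e})" using edges_in_mono[OF E1] by blast
      have disj': "(E1 - {e}) \<inter> E2 = {}" using disj by blast
      show ?thesis
        by (rule step[OF E1 E2 disj RV VR vV vR less.hyps[OF lt1 E1' E2 disj' _ _ vV] True e(2) bR e(4)])
    next
      case False
      then have eE2: "e \<in> E2" using e by blast
      then have "?E - {e} = E1 \<union> (E2 - {e})" using disj by blast
      then have lt2: "card (E1 \<union> (E2 - {e})) < card ?E" using lt by simp
      have E2': "edges_in nd V2 (E2 - {e})" using edges_in_mono[OF E2] by blast
      have disj': "E1 \<inter> (E2 - {e}) = {}" using disj by blast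
      have "compl_poly (forests nd (V2 \<union> V1) (E2 \<union> E1) R) (E2 \<union> E1) \<alpha> =
          compl_poly (forests nd V2 E2 (R \<inter> V2)) E2 \<alpha> * compl_poly (forests nd V1 E1 (insert v (R \<inter> V1))) E1 \<alpha>
          + compl_poly (forests nd V2 E2 (insert v (R \<inter> V2))) E2 \<alpha> * compl_poly (forests nd V1 E1 (R \<inter> V1)) E1 \<alpha>"
      proof (rule step[OF E2 E1 _ _ _ _ vR _ eE2 e(2) bR e(4)])
        fix R assume R: "R \<subseteq> V2 \<union> V1" "V2 \<inter> V1 \<subseteq> insert v R" "v \<notin> R"
        show "compl_poly (forests nd (V2 \<union> V1) ((E2 - {e}) \<union> E1) R) ((E2 - {e}) \<union> E1) \<alpha> =
          compl_poly (forests nd V2 (E2 - {e}) (R \<inter> V2)) (E2 - {e}) \<alpha> *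
          compl_poly (forests nd V1 E1 (insert v (R \<inter> V1))) E1 \<alpha>
          + compl_poly (forests nd V2 (E2 - {e}) (insert v (R \<inter> V2))) (E2 - {e}) \<alpha> *
          compl_poly (forests nd V1 E1 (R \<inter> V1)) E1 \<alpha>"
          using less.hyps[OF lt2 E1 E2' disj' _ _ vV R(3)] R
          by (simp add: Un_commute Int_commute mult.commute add.commute)
      qed (use disj RV VR vV in auto)
      then show ?thesis by (simp add: Un_commute mult.commute add.commute)
    qed
  next
    case False
    have "forests nd ?V ?E R = {}" by (rule forests_empty[OF E]) (use False vV vR in auto)
    moreover have "forests nd V1 E1 (R \<inter> V1) = {}"
      by (rule forests_empty[OF E1]) (use False vV vR in auto)
    moreover have "forests nd V2 E2 (R \<inter> V2) = {}"
      by (rule forests_empty[OF E2]) (use False vV vR in auto)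
    ultimately show ?thesis by simp
  qed
qed

lemma compl_poly_scale:
  assumes "\<And>F. F \<in> \<F> \<Longrightarrow> card (E - F) = k"
  shows "compl_poly \<F> E (\<lambda>e. c * \<alpha> e) = c ^ k * compl_poly \<F> E \<alpha>"
  unfolding compl_poly_def sum_distrib_left
  by (intro sum.cong refl) (simp add: prod.distrib assms)

text \<open>
  Scaling all variables by \<open>c\<close> multiplies the polynomial with the additional root \<open>v\<close> by one more
  factor \<open>c\<close> than the other one, because its forests have one edge less. Hence it carries the
  nonzeros for the parameter \<open>c\<close> bijectively to those for the parameter 1.
\<close>

lemma pencil_count_constant:
  fixes nd :: "'e \<Rightarrow> 'v set" and c :: "'f::{field,finite}"
  assumes "edges_in nd V E" and "v \<in> V - R" and "c \<noteq> 0"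
  shows "card {\<alpha> \<in> E \<rightarrow>\<^sub>E UNIV. compl_poly (forests nd V E R) E \<alpha> + c * compl_poly (forests nd V E (insert v R)) E \<alpha> \<noteq> 0} =
    card {\<alpha> \<in> E \<rightarrow>\<^sub>E (UNIV :: 'f set). compl_poly (forests nd V E R) E \<alpha> + compl_poly (forests nd V E (insert v R)) E \<alpha> \<noteq> 0}"
proof -
  let ?f = "compl_poly (forests nd V E R) E" and ?g = "compl_poly (forests nd V E (insert v R)) E"
  let ?S = "E \<rightarrow>\<^sub>E (UNIV :: 'f set)"
  define n where "n = card E - card (V - insert v R)"
  have fin: "finite V" "finite E" using assms(1) unfolding edges_in_def by auto
  have card: "card (V - R) = Suc (card (V - insert v R))"
    using assms(2) fin by (metis Diff_insert card_Suc_Diff1 finite_Diff)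
  have cardF: "card (E - F) = card E - card F" if "F \<subseteq> E" for F
    using that fin by (simp add: card_Diff_subset finite_subset)
  have g: "?g (\<lambda>e. t * \<alpha> e) = t ^ n * ?g \<alpha>" for t and \<alpha> :: "'e \<Rightarrow> 'f"
    by (rule compl_poly_scale) (auto simp: forests_def cardF n_def)
  \<comment> \<open>With fewer edges than \<open>card (V - R)\<close> the truncated difference would give the wrong exponent, but
    then \<open>?f\<close> is zero.\<close>
  have f: "t * ?f (\<lambda>e. t * \<alpha> e) = t ^ n * ?f \<alpha>" for t and \<alpha> :: "'e \<Rightarrow> 'f"
  proof (cases "card (V - R) \<le> card E")
    case True
    have "?f (\<lambda>e. t * \<alpha> e) = t ^ (card E - card (V - R)) * ?f \<alpha>"
      by (rule compl_poly_scale) (auto simp: forests_def cardF)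
    moreover have "n = Suc (card E - card (V - R))" unfolding n_def using True card by simp
    ultimately show ?thesis by simp
  next
    case False
    have "forests nd V E R = {}"
    proof (rule ccontr)
      assume "forests nd V E R \<noteq> {}"
      then obtain F where "F \<subseteq> E" "card F = card (V - R)" unfolding forests_def by blast
      then show False using False card_mono[OF fin(2)] by metis
    qed
    then show ?thesis by simp
  qed
  have scale: "?f (\<lambda>e. c * \<alpha> e) + ?g (\<lambda>e. c * \<alpha> e) = 0 \<longleftrightarrow> ?f \<alpha> + c * ?g \<alpha> = 0" for \<alpha> :: "'e \<Rightarrow> 'f"
  proof -
    have "c * (?f (\<lambda>e. c * \<alpha> e) + ?g (\<lambda>e. c * \<alpha> e)) = c ^ n * (?f \<alpha> + c * ?g \<alpha>)"
      by (simp add: distrib_left f g)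
    then show ?thesis using assms(3) by (metis mult_eq_0_iff power_not_zero)
  qed
  let ?m = "\<lambda>t (\<alpha> :: 'e \<Rightarrow> 'f). restrict (\<lambda>e. t * \<alpha> e) E"
  have restr: "compl_poly \<F> E (?m t \<alpha>) = compl_poly \<F> E (\<lambda>e. t * \<alpha> e)" for \<F> t \<alpha>
    by (rule compl_poly_cong) simp
  have inv: "?m s (?m t \<alpha>) = \<alpha>" if "\<alpha> \<in> ?S" "s * t = 1" for s t \<alpha>
    using that by (auto simp: fun_eq_iff mult.assoc[symmetric] PiE_def extensional_def)
  have "bij_betw (?m c) {\<alpha> \<in> ?S. ?f \<alpha> + c * ?g \<alpha> \<noteq> 0} {\<alpha> \<in> ?S. ?f \<alpha> + ?g \<alpha> \<noteq> 0}"
  proof (rule bij_betw_byWitness[where f' = "?m (inverse c)"])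
    show "\<forall>\<alpha>\<in>{\<alpha> \<in> ?S. ?f \<alpha> + c * ?g \<alpha> \<noteq> 0}. ?m (inverse c) (?m c \<alpha>) = \<alpha>"
      using inv assms(3) by simp
    show "\<forall>\<alpha>\<in>{\<alpha> \<in> ?S. ?f \<alpha> + ?g \<alpha> \<noteq> 0}. ?m c (?m (inverse c) \<alpha>) = \<alpha>"
      using inv assms(3) by simp
    show "?m c ` {\<alpha> \<in> ?S. ?f \<alpha> + c * ?g \<alpha> \<noteq> 0} \<subseteq> {\<alpha> \<in> ?S. ?f \<alpha> + ?g \<alpha> \<noteq> 0}"
      using scale restr by auto
    show "?m (inverse c) ` {\<alpha> \<in> ?S. ?f \<alpha> + ?g \<alpha> \<noteq> 0} \<subseteq> {\<alpha> \<in> ?S. ?f \<alpha> + c * ?g \<alpha> \<noteq> 0}"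
    proof (rule image_subsetI)
      fix \<alpha> assume \<alpha>: "\<alpha> \<in> {\<alpha> \<in> ?S. ?f \<alpha> + ?g \<alpha> \<noteq> 0}"
      let ?\<beta> = "?m (inverse c) \<alpha>"
      have "?m c ?\<beta> = \<alpha>" using inv assms(3) \<alpha> by simp
      then have "?f (\<lambda>e. c * ?\<beta> e) + ?g (\<lambda>e. c * ?\<beta> e) \<noteq> 0" using \<alpha> restr[of _ c ?\<beta>] by simp
      then show "?\<beta> \<in> {\<alpha> \<in> ?S. ?f \<alpha> + c * ?g \<alpha> \<noteq> 0}" using scale[of ?\<beta>] by simp
    qed
  qed
  then show ?thesis by (rule bij_betw_same_card)
qed

lemma card_PiE_Un:
  fixes E1 E2 :: "'e set"
  assumes "finite E1" and "finite E2" and "E1 \<inter> E2 = {}"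
  shows "card {\<alpha> \<in> (E1 \<union> E2) \<rightarrow>\<^sub>E (UNIV :: 'f::finite set). Q \<alpha>} =
    (\<Sum>\<beta>\<in>E2 \<rightarrow>\<^sub>E UNIV. card {\<gamma> \<in> E1 \<rightarrow>\<^sub>E UNIV. Q (\<lambda>e. if e \<in> E1 then \<gamma> e else \<beta> e)})"
proof -
  let ?j = "\<lambda>\<beta> \<gamma> e. if e \<in> E1 then \<gamma> e else \<beta> e :: 'f"
  let ?S = "SIGMA \<beta>:E2 \<rightarrow>\<^sub>E (UNIV :: 'f set). {\<gamma> \<in> E1 \<rightarrow>\<^sub>E UNIV. Q (?j \<beta> \<gamma>)}"
  have "bij_betw (\<lambda>(\<beta>, \<gamma>). ?j \<beta> \<gamma>) ?S {\<alpha> \<in> (E1 \<union> E2) \<rightarrow>\<^sub>E UNIV. Q \<alpha>}"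
  proof (rule bij_betw_byWitness[where f' = "\<lambda>\<alpha>. (restrict \<alpha> E2, restrict \<alpha> E1)"])
    have 1: "restrict (?j \<beta> \<gamma>) E2 = \<beta> \<and> restrict (?j \<beta> \<gamma>) E1 = \<gamma>"
      if "\<beta> \<in> E2 \<rightarrow>\<^sub>E UNIV" "\<gamma> \<in> E1 \<rightarrow>\<^sub>E UNIV" for \<beta> \<gamma>
      using that assms(3) by (auto simp: fun_eq_iff PiE_def extensional_def)
    have 2: "?j (restrict \<alpha> E2) (restrict \<alpha> E1) = \<alpha>" if "\<alpha> \<in> (E1 \<union> E2) \<rightarrow>\<^sub>E UNIV" for \<alpha>
      using that by (auto simp: fun_eq_iff PiE_def extensional_def)
    show "\<forall>x\<in>?S. (\<lambda>\<alpha>. (restrict \<alpha> E2, restrict \<alpha> E1)) ((\<lambda>(\<beta>, \<gamma>). ?j \<beta> \<gamma>) x) = x"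
      using 1 by auto
    show "\<forall>\<alpha>\<in>{\<alpha> \<in> (E1 \<union> E2) \<rightarrow>\<^sub>E UNIV. Q \<alpha>}.
        (\<lambda>(\<beta>, \<gamma>). ?j \<beta> \<gamma>) (restrict \<alpha> E2, restrict \<alpha> E1) = \<alpha>"
      using 2 by simp
    show "(\<lambda>(\<beta>, \<gamma>). ?j \<beta> \<gamma>) ` ?S \<subseteq> {\<alpha> \<in> (E1 \<union> E2) \<rightarrow>\<^sub>E UNIV. Q \<alpha>}"
      by (auto simp: PiE_def extensional_def)
    show "(\<lambda>\<alpha>. (restrict \<alpha> E2, restrict \<alpha> E1)) ` {\<alpha> \<in> (E1 \<union> E2) \<rightarrow>\<^sub>E UNIV. Q \<alpha>} \<subseteq> ?S"
      using 2 by auto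
  qed
  then have "card {\<alpha> \<in> (E1 \<union> E2) \<rightarrow>\<^sub>E (UNIV :: 'f set). Q \<alpha>} = card ?S"
    by (rule bij_betw_same_card[symmetric])
  also have "\<dots> = (\<Sum>\<beta>\<in>E2 \<rightarrow>\<^sub>E UNIV. card {\<gamma> \<in> E1 \<rightarrow>\<^sub>E UNIV. Q (?j \<beta> \<gamma>)})"
    using finite_points[OF assms(1), where 'f = 'f] finite_points[OF assms(2), where 'f = 'f]
    by (subst card_SigmaI) auto
  finally show ?thesis .
qed

text \<open>
  For fixed values \<open>A\<close> of \<open>f2\<close> and \<open>B\<close> of \<open>g2\<close> the inner count depends only on which of them vanish: it is
  \<open>M1\<close>, \<open>P1\<close>, \<open>d\<close> or zero, where \<open>d\<close> counts the nonzeros of \<open>f1 + c * g1\<close> for any \<open>c \<noteq> 0\<close>. Counting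
  the pairs of a point and a parameter \<open>c\<close> in two ways determines \<open>d\<close> and shows that
  \<open>M1 - d\<close> is divisible by \<open>q\<^sup>2\<close>, although each of \<open>M1\<close> and \<open>d\<close> need only be divisible by \<open>q\<close>.
\<close>

lemma bilinear_nonzero_count:
  fixes f1 g1 :: "'a \<Rightarrow> 'f::{field,finite}" and f2 g2 :: "'b \<Rightarrow> 'f"
  assumes fin: "finite S" "finite T"
    and pencil: "\<And>c. c \<noteq> 0 \<Longrightarrow> card {\<gamma>\<in>S. f1 \<gamma> + c * g1 \<gamma> \<noteq> 0} = card {\<gamma>\<in>S. f1 \<gamma> + g1 \<gamma> \<noteq> 0}"
    and p1: "(int CARD('f))\<^sup>2 dvd int (card {\<gamma>\<in>S. f1 \<gamma> \<noteq> 0})"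
    and m1: "int CARD('f) dvd int (card {\<gamma>\<in>S. g1 \<gamma> \<noteq> 0})"
    and n1: "int CARD('f) dvd int (card {\<gamma>\<in>S. \<not> (f1 \<gamma> = 0 \<and> g1 \<gamma> = 0)})"
    and p2: "(int CARD('f))\<^sup>2 dvd int (card {\<beta>\<in>T. f2 \<beta> \<noteq> 0})"
    and m2: "int CARD('f) dvd int (card {\<beta>\<in>T. g2 \<beta> \<noteq> 0})"
    and n2: "int CARD('f) dvd int (card {\<beta>\<in>T. \<not> (f2 \<beta> = 0 \<and> g2 \<beta> = 0)})"
  shows "(int CARD('f))^3 dvd (\<Sum>\<beta>\<in>T. int (card {\<gamma>\<in>S. f1 \<gamma> * g2 \<beta> + g1 \<gamma> * f2 \<beta> \<noteq> 0}))"
proof -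
  define q where "q = int CARD('f)"
  define d where "d = int (card {\<gamma>\<in>S. f1 \<gamma> + g1 \<gamma> \<noteq> 0})"
  define P1 where "P1 = int (card {\<gamma>\<in>S. f1 \<gamma> \<noteq> 0})"
  define M1 where "M1 = int (card {\<gamma>\<in>S. g1 \<gamma> \<noteq> 0})"
  define N1 where "N1 = int (card {\<gamma>\<in>S. \<not> (f1 \<gamma> = 0 \<and> g1 \<gamma> = 0)})"
  define P2 where "P2 = int (card {\<beta>\<in>T. f2 \<beta> \<noteq> 0})"
  define M2 where "M2 = int (card {\<beta>\<in>T. g2 \<beta> \<noteq> 0})"
  define N2 where "N2 = int (card {\<beta>\<in>T. \<not> (f2 \<beta> = 0 \<and> g2 \<beta> = 0)})"
  have row: "int (card {\<gamma>\<in>S. f1 \<gamma> * B + g1 \<gamma> * A \<noteq> 0}) =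
      M1 * (of_bool (\<not> (A = 0 \<and> B = 0)) - of_bool (B \<noteq> 0))
      + P1 * (of_bool (\<not> (A = 0 \<and> B = 0)) - of_bool (A \<noteq> 0))
      + d * (of_bool (A \<noteq> 0) + of_bool (B \<noteq> 0) - of_bool (\<not> (A = 0 \<and> B = 0)))" for A B
  proof (cases "A = 0 \<or> B = 0")
    case True
    then show ?thesis unfolding M1_def P1_def by auto
  next
    case False
    have "f1 \<gamma> * B + g1 \<gamma> * A = B * (f1 \<gamma> + (A / B) * g1 \<gamma>)" for \<gamma>
      using False by (simp add: field_simps)
    then have "{\<gamma>\<in>S. f1 \<gamma> * B + g1 \<gamma> * A \<noteq> 0} = {\<gamma>\<in>S. f1 \<gamma> + (A / B) * g1 \<gamma> \<noteq> 0}"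
      using False by simp
    then show ?thesis using pencil[of "A / B"] False unfolding d_def by simp
  qed
  have W: "(\<Sum>\<beta>\<in>T. int (card {\<gamma>\<in>S. f1 \<gamma> * g2 \<beta> + g1 \<gamma> * f2 \<beta> \<noteq> 0})) =
      M1 * (N2 - M2) + P1 * (N2 - P2) + d * (P2 + M2 - N2)"
    unfolding row sum.distrib sum_distrib_left[symmetric] sum_subtractf sum_of_bool_card[OF fin(2)]
      P2_def M2_def N2_def ..
  \<comment> \<open>The double count: for each point \<open>\<gamma>\<close> the parameters \<open>c\<close> are counted by
    \<open>card_affine_nonzero\<close>; for each \<open>c \<noteq> 0\<close> the points are counted by \<open>d\<close>.\<close>
  have "(\<Sum>c\<in>UNIV. int (card {\<gamma>\<in>S. f1 \<gamma> + c * g1 \<gamma> \<noteq> 0})) =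
      (\<Sum>c\<in>UNIV. \<Sum>\<gamma>\<in>S. of_bool (f1 \<gamma> + c * g1 \<gamma> \<noteq> 0))"
    unfolding sum_of_bool_card[OF fin(1)] ..
  also have "\<dots> = (\<Sum>\<gamma>\<in>S. \<Sum>c\<in>UNIV. of_bool (f1 \<gamma> + c * g1 \<gamma> \<noteq> 0))"
    by (rule sum.swap)
  also have "\<dots> = (\<Sum>\<gamma>\<in>S. int (card {c. c * g1 \<gamma> + f1 \<gamma> \<noteq> 0}))"
    unfolding sum_of_bool_card[OF finite_class.finite_UNIV] by (simp add: add.commute)
  also have "\<dots> = q * N1 - M1"
    unfolding card_affine_nonzero sum_subtractf sum_distrib_left[symmetric] sum_of_bool_card[OF fin(1)]
      q_def N1_def M1_def by (simp add: conj_commute)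
  finally have "(\<Sum>c\<in>UNIV. int (card {\<gamma>\<in>S. f1 \<gamma> + c * g1 \<gamma> \<noteq> 0})) = q * N1 - M1" .
  moreover have "(\<Sum>c\<in>UNIV. int (card {\<gamma>\<in>S. f1 \<gamma> + c * g1 \<gamma> \<noteq> 0})) = P1 + (q - 1) * d"
  proof -
    have "(\<Sum>c\<in>UNIV. int (card {\<gamma>\<in>S. f1 \<gamma> + c * g1 \<gamma> \<noteq> 0})) =
        P1 + (\<Sum>c\<in>UNIV - {0}. int (card {\<gamma>\<in>S. f1 \<gamma> + c * g1 \<gamma> \<noteq> 0}))"
      unfolding P1_def by (subst sum.remove[of UNIV 0]) auto
    also have "(\<Sum>c\<in>UNIV - {0}. int (card {\<gamma>\<in>S. f1 \<gamma> + c * g1 \<gamma> \<noteq> 0})) = (\<Sum>c\<in>UNIV - {0::'f}. d)"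
      unfolding d_def by (intro sum.cong refl) (simp add: pencil)
    also have "\<dots> = (q - 1) * d" unfolding q_def by (simp add: card_Diff_subset of_nat_diff Suc_leI)
    finally show ?thesis .
  qed
  ultimately have d: "d = q * (d - N1) + M1 + P1" by (simp add: algebra_simps)
  have P1: "q\<^sup>2 dvd P1" and M1: "q dvd M1" and N1: "q dvd N1" and P2: "q\<^sup>2 dvd P2"
    and M2: "q dvd M2" and N2: "q dvd N2"
    using p1 m1 n1 p2 m2 n2 unfolding q_def P1_def M1_def N1_def P2_def M2_def N2_def by auto
  have q2: "q dvd x" if "q\<^sup>2 dvd x" for x using that by (metis dvd_mult_left power2_eq_square)
  have qd: "q dvd d" by (subst d) (intro dvd_add dvd_triv_left M1 q2[OF P1])
  have "M1 - d = q * (N1 - d) - P1" using d by (simp add: algebra_simps)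
  moreover have "q\<^sup>2 dvd q * (N1 - d)"
    unfolding power2_eq_square by (intro mult_dvd_mono dvd_refl dvd_diff N1 qd)
  ultimately have Md: "q\<^sup>2 dvd M1 - d" using P1 by (metis dvd_diff)
  have "M1 * (N2 - M2) + P1 * (N2 - P2) + d * (P2 + M2 - N2) =
      (M1 - d) * (N2 - M2) + P1 * (N2 - P2) + P2 * d" by (simp add: algebra_simps)
  also have "q\<^sup>2 * q dvd \<dots>"
    by (intro dvd_add mult_dvd_mono Md P1 P2 dvd_diff N2 M2 qd q2[OF P2])
  finally show ?thesis unfolding W q_def by (simp add: power2_eq_square power3_eq_cube)
qed

lemma glued_nonzero_count:
  fixes nd :: "'e \<Rightarrow> 'v set"
  assumes E1: "edges_in nd V1 E1" and E2: "edges_in nd V2 E2" and disj: "E1 \<inter> E2 = {}"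
    and uv: "V1 \<inter> V2 = {u, v}" "u \<noteq> v" and V1: "\<not> V1 \<subseteq> {u, v}" and V2: "\<not> V2 \<subseteq> {u, v}"
  shows "(int CARD('f))^3 dvd int (card {\<alpha> \<in> (E1 \<union> E2) \<rightarrow>\<^sub>E (UNIV :: 'f::{field,finite} set).
    compl_poly (forests nd (V1 \<union> V2) (E1 \<union> E2) {u}) (E1 \<union> E2) \<alpha> \<noteq> 0})"
proof -
  let ?f1 = "compl_poly (forests nd V1 E1 {u}) E1 :: ('e \<Rightarrow> 'f) \<Rightarrow> 'f"
  let ?g1 = "compl_poly (forests nd V1 E1 {v, u}) E1 :: ('e \<Rightarrow> 'f) \<Rightarrow> 'f"
  let ?f2 = "compl_poly (forests nd V2 E2 {u}) E2 :: ('e \<Rightarrow> 'f) \<Rightarrow> 'f"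
  let ?g2 = "compl_poly (forests nd V2 E2 {v, u}) E2 :: ('e \<Rightarrow> 'f) \<Rightarrow> 'f"
  have fin: "finite E1" "finite E2" "finite V1" "finite V2" using E1 E2 unfolding edges_in_def by auto
  have in12: "u \<in> V1" "u \<in> V2" "v \<in> V1" "v \<in> V2" using uv by auto
  have big: "2 \<le> card (W - {u})" if W: "\<not> W \<subseteq> {u, v}" "v \<in> W" "finite W" for W
  proof -
    obtain y where y: "y \<in> W" "y \<noteq> u" "y \<noteq> v" using W by blast
    have "card {v, y} \<le> card (W - {u})" using y W uv by (intro card_mono) auto
    then show ?thesis using y by simp
  qed
  have glue: "compl_poly (forests nd (V1 \<union> V2) (E1 \<union> E2) {u}) (E1 \<union> E2) \<alpha> = ?f1 \<alpha> * ?g2 \<alpha> + ?g1 \<alpha> * ?f2 \<alpha>" for \<alpha>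
  proof -
    have "{u} \<inter> V1 = {u}" "{u} \<inter> V2 = {u}" using in12 by auto
    then show ?thesis using forests_glue_two[OF E1 E2 disj, of "{u}" v \<alpha>] uv in12 by auto
  qed
  have join: "compl_poly \<F> E1 (\<lambda>e. if e \<in> E1 then \<gamma> e else \<beta> e) = compl_poly \<F> E1 \<gamma>"
    "compl_poly \<F> E2 (\<lambda>e. if e \<in> E1 then \<gamma> e else \<beta> e) = compl_poly \<F> E2 \<beta>" for \<F> and \<gamma> \<beta> :: "'e \<Rightarrow> 'f"
    by (rule compl_poly_cong; use disj in auto)+
  have count: "int (card {\<alpha> \<in> (E1 \<union> E2) \<rightarrow>\<^sub>E (UNIV :: 'f set).
      compl_poly (forests nd (V1 \<union> V2) (E1 \<union> E2) {u}) (E1 \<union> E2) \<alpha> \<noteq> 0}) =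
      (\<Sum>\<beta>\<in>E2 \<rightarrow>\<^sub>E UNIV. int (card {\<gamma> \<in> E1 \<rightarrow>\<^sub>E UNIV. ?f1 \<gamma> * ?g2 \<beta> + ?g1 \<gamma> * ?f2 \<beta> \<noteq> 0}))"
    unfolding card_PiE_Un[OF fin(1,2) disj] glue join by simp
  show ?thesis
    unfolding count
  proof (rule bilinear_nonzero_count)
    show "finite (E1 \<rightarrow>\<^sub>E (UNIV :: 'f set))" "finite (E2 \<rightarrow>\<^sub>E (UNIV :: 'f set))"
      using fin finite_points by auto
    show "card {\<gamma> \<in> E1 \<rightarrow>\<^sub>E UNIV. ?f1 \<gamma> + c * ?g1 \<gamma> \<noteq> 0} = card {\<gamma> \<in> E1 \<rightarrow>\<^sub>E UNIV. ?f1 \<gamma> + ?g1 \<gamma> \<noteq> 0}"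
      if "c \<noteq> 0" for c
      by (rule pencil_count_constant[OF E1 _ that]) (use uv in12 in auto)
    show "(int CARD('f))\<^sup>2 dvd int (card {\<gamma> \<in> E1 \<rightarrow>\<^sub>E UNIV. ?f1 \<gamma> \<noteq> 0})"
      by (rule forests_nonzero_count_square[OF E1 _ big]) (use V1 fin in12 in auto)
    show "(int CARD('f))\<^sup>2 dvd int (card {\<gamma> \<in> E2 \<rightarrow>\<^sub>E UNIV. ?f2 \<gamma> \<noteq> 0})"
      by (rule forests_nonzero_count_square[OF E2 _ big]) (use V2 fin in12 in auto)
    show "int CARD('f) dvd int (card {\<gamma> \<in> E1 \<rightarrow>\<^sub>E UNIV. ?g1 \<gamma> \<noteq> 0})"
      by (rule warning_forests[OF E1]) (use V1 in auto)
    show "int CARD('f) dvd int (card {\<gamma> \<in> E2 \<rightarrow>\<^sub>E UNIV. ?g2 \<gamma> \<noteq> 0})"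
      by (rule warning_forests[OF E2]) (use V2 in auto)
    show "int CARD('f) dvd int (card {\<gamma> \<in> E1 \<rightarrow>\<^sub>E UNIV. \<not> (?f1 \<gamma> = 0 \<and> ?g1 \<gamma> = 0)})"
      by (rule two_roots_nonzero_count[OF E1]) (use V1 uv in12 in auto)
    show "int CARD('f) dvd int (card {\<gamma> \<in> E2 \<rightarrow>\<^sub>E UNIV. \<not> (?f2 \<gamma> = 0 \<and> ?g2 \<gamma> = 0)})"
      by (rule two_roots_nonzero_count[OF E2]) (use V2 uv in12 in auto)
  qed
qed

section \<open>Spanning trees as forests with one root\<close>

lemma link_redundant:
  assumes "nd e = {a, b}" and "(a, b) \<in> (link nd (F - {e}))\<^sup>*" and "(x, y) \<in> (link nd F)\<^sup>*"
  shows "(x, y) \<in> (link nd (F - {e}))\<^sup>*"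
  using assms(3)
proof (induction rule: rtrancl_induct)
  case (step y z)
  from step.hyps(2) obtain e' where e': "e' \<in> F" "nd e' = {y, z}"
    unfolding link_def by auto
  have "(y, z) \<in> (link nd (F - {e}))\<^sup>*"
  proof (cases "e' = e")
    case True
    then have "y = a \<and> z = b \<or> y = b \<and> z = a" using e' assms(1) by (auto simp: doubleton_eq_iff)
    then show ?thesis using assms(2) link_sym by metis
  next
    case False
    then show ?thesis using e' linkI[of e' "F - {e}" nd y z] by simp
  qed
  then show ?case using step.IH by (rule link_trans[rotated])
qed simp

text \<open>
  By induction along a walk: when it returns to a vertex, the path is cut back to the first visit.
\<close>

lemma link_simple_path:
  assumes "(a, b) \<in> (link nd F)\<^sup>*"
  shows "\<exists>vs fs. length vs = Suc (length fs) \<and> vs ! 0 = a \<and> vs ! length fs = b \<and> distinct vs \<and>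
    set fs \<subseteq> F \<and> (\<forall>i<length fs. nd (fs ! i) = {vs ! i, vs ! Suc i})"
  using assms
proof (induction rule: rtrancl_induct)
  case base
  show ?case by (rule exI[of _ "[a]"], rule exI[of _ "[]"]) simp
next
  case (step y z)
  from step.hyps(2) obtain f where f: "f \<in> F" "nd f = {y, z}"
    unfolding link_def by auto
  from step.IH obtain vs fs where p: "length vs = Suc (length fs)" "vs ! 0 = a" "vs ! length fs = y"
    "distinct vs" "set fs \<subseteq> F" "\<forall>i<length fs. nd (fs ! i) = {vs ! i, vs ! Suc i}" by blast
  show ?case
  proof (cases "z \<in> set vs")
    case True
    then obtain j where j: "j < length vs" "vs ! j = z" by (auto simp: in_set_conv_nth)
    have len: "length (take j fs) = j" using j(1) p(1) by simp
    have "set (take j fs) \<subseteq> F" using p(5) by (rule subset_trans[OF set_take_subset])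
    then show ?thesis
      using p(1,2,4,6) j by (intro exI[of _ "take (Suc j) vs"] exI[of _ "take j fs"]) (simp add: len)
  next
    case False
    show ?thesis
    proof (intro exI[of _ "vs @ [z]"] exI[of _ "fs @ [f]"] conjI allI impI)
      fix i assume "i < length (fs @ [f])"
      then consider "i < length fs" | "i = length fs" by fastforce
      then show "nd ((fs @ [f]) ! i) = {(vs @ [z]) ! i, (vs @ [z]) ! Suc i}"
      proof cases
        case 1
        then show ?thesis using p by (simp add: nth_append)
      next
        case 2
        then show ?thesis using p f by (simp add: nth_append)
      qed
    qed (use p f False in \<open>auto simp: nth_append\<close>)
  qed
qed

lemma cycle_edge_redundant:
  assumes "cycle G vs es"
  obtains e a b where "e \<in> edges G" "ends G e = {a, b}"
    "(a, b) \<in> (link (ends G) (edges G - {e}))\<^sup>*"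
proof -
  have c: "es \<noteq> []" "length vs = length es" "distinct es" "set es \<subseteq> edges G"
    "\<And>i. i < length es \<Longrightarrow> ends G (es ! i) = {vs ! i, vs ! (Suc i mod length es)}"
    using assms unfolding cycle_def by simp_all
  define n where "n = length es - 1"
  have n: "length es = Suc n" unfolding n_def using c(1) by simp
  have path: "(vs ! 0, vs ! i) \<in> (link (ends G) (edges G - {es ! n}))\<^sup>*" if "i \<le> n" for i
    using that
  proof (induction i)
    case (Suc i)
    have "es ! i \<noteq> es ! n" using c(3) n Suc.prems by (simp add: nth_eq_iff_index_eq)
    moreover have "es ! i \<in> edges G" using c(4) n Suc.prems by (intro subsetD[OF c(4)] nth_mem) simp
    moreover have "ends G (es ! i) = {vs ! i, vs ! Suc i}" using c(5)[of i] n Suc.prems by simp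
    ultimately have "(vs ! i, vs ! Suc i) \<in> (link (ends G) (edges G - {es ! n}))\<^sup>*"
      by (intro linkI) auto
    then show ?case by (rule link_trans[OF Suc.IH[OF Suc_leD[OF Suc.prems]]])
  qed simp
  show ?thesis
  proof (rule that)
    show "es ! n \<in> edges G" using n by (intro subsetD[OF c(4)] nth_mem) simp
    show "ends G (es ! n) = {vs ! 0, vs ! n}" using c(5)[of n] n by (simp add: insert_commute)
    show "(vs ! 0, vs ! n) \<in> (link (ends G) (edges G - {es ! n}))\<^sup>*" by (rule path) simp
  qed
qed

lemma chord_gives_cycle:
  assumes "e \<in> edges G" and "ends G e = {a, b}" and "(a, b) \<in> (link (ends G) F)\<^sup>*"
    and "F \<subseteq> edges G" and "e \<notin> F"
  shows "\<exists>vs es. cycle G vs es"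
proof -
  from link_simple_path[OF assms(3)] obtain vs fs where
    p: "length vs = Suc (length fs)" "vs ! 0 = a" "vs ! length fs = b"
    "distinct vs" "set fs \<subseteq> F" "\<And>i. i < length fs \<Longrightarrow> ends G (fs ! i) = {vs ! i, vs ! Suc i}" by blast
  have "distinct fs"
    unfolding distinct_conv_nth
  proof (intro allI impI notI)
    fix i j assume ij: "i < length fs" "j < length fs" "i \<noteq> j" "fs ! i = fs ! j"
    then have "{vs ! i, vs ! Suc i} = {vs ! j, vs ! Suc j}" using p(6) by metis
    then have "vs ! i = vs ! j \<or> vs ! i = vs ! Suc j \<and> vs ! Suc i = vs ! j"
      by (auto simp: doubleton_eq_iff)
    then show False using ij p(1,4) by (auto simp: nth_eq_iff_index_eq)
  qed
  then have "cycle G vs (fs @ [e])"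
    unfolding cycle_def
  proof (intro conjI allI impI)
    fix i assume "i < length (fs @ [e])"
    then consider "i < length fs" | "i = length fs" by fastforce
    then show "ends G ((fs @ [e]) ! i) = {vs ! i, vs ! (Suc i mod length (fs @ [e]))}"
      using p assms(2) by cases (auto simp: nth_append)
  qed (use p assms in auto)
  then show ?thesis by blast
qed

lemma finite_multigraph_edges_in:
  assumes "finite_multigraph G"
  shows "edges_in (ends G) (verts G) (edges G)"
  unfolding edges_in_def
proof (intro conjI ballI)
  fix e assume e: "e \<in> edges G"
  then have sub: "ends G e \<subseteq> verts G" and "card (ends G e) = 1 \<or> card (ends G e) = 2"
    using assms unfolding finite_multigraph_def by auto
  then obtain a b where "ends G e = {a, b}"
    by (metis card_1_singletonE card_2_iff insert_absorb2)
  then show "\<exists>a\<in>verts G. \<exists>b\<in>verts G. ends G e = {a, b}" using sub by auto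
qed (use assms in \<open>auto simp: finite_multigraph_def\<close>)

lemma adjacency_eq_link: "adjacency G = link (ends G) (edges G)"
  unfolding adjacency_def link_def ..

lemma spans_root_linked:
  assumes "spans nd V {u} F" and "x \<in> V" and "y \<in> V"
  shows "(x, y) \<in> (link nd F)\<^sup>*"
proof (rule link_trans)
  show "(x, u) \<in> (link nd F)\<^sup>*" using assms(1,2) link_sym[of u x nd F] unfolding spans_def by blast
  show "(u, y) \<in> (link nd F)\<^sup>*" using assms(1,3) unfolding spans_def by blast
qed

lemma connected_graph_iff_spans:
  assumes "u \<in> verts G"
  shows "connected_graph G \<longleftrightarrow> spans (ends G) (verts G) {u} (edges G)"
proof
  assume "spans (ends G) (verts G) {u} (edges G)"
  then show "connected_graph G"
    unfolding connected_graph_def joined_def adjacency_eq_link by (simp add: spans_root_linked)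
qed (use assms in \<open>simp add: connected_graph_def joined_def adjacency_eq_link spans_def\<close>)

text \<open>
  For an edge set that connects all vertices, acyclicity amounts to having one edge less than there
  are vertices: an edge on a cycle is redundant, and an edge outside a spanning forest closes
  a cycle with the path in the forest between its ends.
\<close>

lemma spanning_trees_eq_forests:
  assumes G: "finite_multigraph G" and u: "u \<in> verts G"
  shows "spanning_trees G = forests (ends G) (verts G) (edges G) {u}"
proof -
  let ?nd = "ends G" and ?V = "verts G"
  note E = finite_multigraph_edges_in[OF G]
  have "tree_graph (G\<lparr>edges := T\<rparr>) \<longleftrightarrow> T \<in> forests ?nd ?V (edges G) {u}" if T: "T \<subseteq> edges G" for T
  proof -
    let ?G = "G\<lparr>edges := T\<rparr>"
    have ET: "edges_in ?nd ?V T" by (rule edges_in_mono[OF E T])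
    have finT: "finite T" using ET unfolding edges_in_def by simp
    have conn: "connected_graph ?G \<longleftrightarrow> spans ?nd ?V {u} T"
      using connected_graph_iff_spans[of u ?G] u by simp
    have "card T = card (?V - {u}) \<longleftrightarrow> \<not> (\<exists>vs es. cycle ?G vs es)" if s: "spans ?nd ?V {u} T"
    proof
      assume card: "card T = card (?V - {u})"
      show "\<not> (\<exists>vs es. cycle ?G vs es)"
      proof
        assume "\<exists>vs es. cycle ?G vs es"
        then obtain vs es where "cycle ?G vs es" by blast
        then obtain e a b where "e \<in> edges ?G" "ends ?G e = {a, b}"
          "(a, b) \<in> (link (ends ?G) (edges ?G - {e}))\<^sup>*" by (rule cycle_edge_redundant)
        then have e: "e \<in> T" "?nd e = {a, b}" "(a, b) \<in> (link ?nd (T - {e}))\<^sup>*" by simp_all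
        have "spans ?nd ?V {u} (T - {e})"
          using s link_redundant[OF e(2,3)] unfolding spans_def by blast
        moreover have "edges_in ?nd ?V (T - {e})" by (rule edges_in_mono[OF ET]) blast
        ultimately have "card (?V - {u}) \<le> card (T - {e})" by (rule spans_card_le[rotated])
        then show False using card card_Diff1_less[OF finT e(1)] by simp
      qed
    next
      assume acyc: "\<not> (\<exists>vs es. cycle ?G vs es)"
      obtain F where F: "F \<subseteq> T" "card F = card (?V - {u})" "spans ?nd ?V {u} F"
        using forest_exists[OF ET s] unfolding forests_def by blast
      have "T \<subseteq> F"
      proof (rule ccontr)
        assume "\<not> T \<subseteq> F"
        then obtain e where e: "e \<in> T" "e \<notin> F" by blast
        then obtain a b where ab: "?nd e = {a, b}" "a \<in> ?V" "b \<in> ?V"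
          using ET unfolding edges_in_def by blast
        have "(a, b) \<in> (link ?nd F)\<^sup>*"
          by (rule spans_root_linked[OF F(3) ab(2,3)])
        then show False using chord_gives_cycle[of e ?G a b F] e ab F(1) acyc by simp
      qed
      then show "card T = card (?V - {u})" using F by (metis subset_antisym)
    qed
    then show ?thesis unfolding tree_graph_def conn forests_def using T by blast
  qed
  then show ?thesis unfolding spanning_trees_def unfolding forests_def by blast
qed

section \<open>The point count of a 2-vertex reducible graph\<close>

lemma graph_polynomial_eq_compl_poly:
  "graph_polynomial G \<alpha> = compl_poly (spanning_trees G) (edges G) \<alpha>"
  unfolding graph_polynomial_def compl_poly_def ..

text \<open>
  The side \<open>V1\<close> consists of \<open>u\<close>, \<open>v\<close> and one component \<open>A\<close> of the graph without them, with the
  edges that meet \<open>A\<close>. All remaining edges, including those between \<open>u\<close> and \<open>v\<close> and the self-loops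
  at these vertices, go to the other side.
\<close>

lemma cube_dvd_point_count:
  fixes G :: "('v, 'e) multigraph"
  assumes G: "finite_multigraph G" and "3 \<le> card (edges G)" and "two_vertex_reducible G"
  shows "int CARD('f) ^ 3 dvd int (point_count TYPE('f::{field,finite}) G)"
proof -
  let ?nd = "ends G" and ?V = "verts G" and ?E = "edges G"
  note E = finite_multigraph_edges_in[OF G]
  have finE: "finite ?E" and finV: "finite ?V" using E unfolding edges_in_def by auto
  obtain u v where u: "u \<in> ?V" and v: "v \<in> ?V" and "u \<noteq> v"
    and disc: "\<not> connected_graph (delete_vertices G {u, v})"
    using assms(3) unfolding two_vertex_reducible_def by blast
  define L where "L = {e \<in> ?E. ?nd e \<inter> {u, v} = {}}"
  have "connected_graph (delete_vertices G {u, v})"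
    if "\<And>x y. x \<in> ?V - {u, v} \<Longrightarrow> y \<in> ?V - {u, v} \<Longrightarrow> (x, y) \<in> (link ?nd L)\<^sup>*"
    using that
    by (simp add: connected_graph_def joined_def adjacency_eq_link delete_vertices_def L_def)
  then obtain x y where x: "x \<in> ?V - {u, v}" and y: "y \<in> ?V - {u, v}" and xy: "(x, y) \<notin> (link ?nd L)\<^sup>*"
    using disc by blast
  define A where "A = {z \<in> ?V - {u, v}. (x, z) \<in> (link ?nd L)\<^sup>*}"
  define V1 where "V1 = insert u (insert v A)"
  define V2 where "V2 = ?V - A"
  define E1 where "E1 = {e \<in> ?E. ?nd e \<inter> A \<noteq> {}}"
  define E2 where "E2 = {e \<in> ?E. ?nd e \<inter> A = {}}"
  have V: "V1 \<union> V2 = ?V" and V12: "V1 \<inter> V2 = {u, v}"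
    using u v unfolding V1_def V2_def A_def by auto
  have E_Un: "E1 \<union> E2 = ?E" and disj: "E1 \<inter> E2 = {}" unfolding E1_def E2_def by auto
  have E1: "edges_in ?nd V1 E1"
    unfolding edges_in_def
  proof (intro conjI ballI)
    show "finite V1" using finV V by (metis finite_Un)
    show "finite E1" using finE unfolding E1_def by simp
    fix e assume e: "e \<in> E1"
    then obtain a b where ab: "?nd e = {a, b}" "a \<in> A" "b \<in> ?V"
    proof -
      obtain a where a: "a \<in> ?nd e" "a \<in> A" using e unfolding E1_def by blast
      obtain c d where cd: "?nd e = {c, d}" "c \<in> ?V" "d \<in> ?V"
        using e E unfolding E1_def edges_in_def by blast
      then consider "a = c" | "a = d" using a by auto
      then show ?thesis
      proof cases
        case 1
        then show ?thesis using that[of c d] cd a by simp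
      next
        case 2
        then show ?thesis using that[of d c] cd a by (simp add: insert_commute)
      qed
    qed
    have "b \<in> V1"
    proof (cases "b \<in> {u, v}")
      case False
      then have "e \<in> L" using e ab unfolding L_def E1_def A_def by auto
      then have "(a, b) \<in> (link ?nd L)\<^sup>*" using ab(1) by (rule linkI)
      moreover have "(x, a) \<in> (link ?nd L)\<^sup>*" using ab(2) unfolding A_def by simp
      ultimately have "(x, b) \<in> (link ?nd L)\<^sup>*" by (rule link_trans[rotated])
      then show ?thesis using False ab(3) unfolding V1_def A_def by simp
    qed (auto simp: V1_def)
    moreover have "a \<in> V1" using ab(2) unfolding V1_def by simp
    ultimately show "\<exists>a\<in>V1. \<exists>b\<in>V1. ?nd e = {a, b}" using ab(1) by blast
  qed
  have E2: "edges_in ?nd V2 E2"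
    unfolding edges_in_def
  proof (intro conjI ballI)
    show "finite V2" using finV unfolding V2_def by simp
    show "finite E2" using finE unfolding E2_def by simp
    fix e assume e: "e \<in> E2"
    then obtain a b where "?nd e = {a, b}" "a \<in> ?V" "b \<in> ?V"
      using E unfolding E2_def edges_in_def by blast
    then show "\<exists>a\<in>V2. \<exists>b\<in>V2. ?nd e = {a, b}" using e unfolding E2_def V2_def by blast
  qed
  have "x \<in> V1" using x unfolding V1_def A_def by simp
  then have nV1: "\<not> V1 \<subseteq> {u, v}" using x by blast
  have "y \<in> V2" using y xy unfolding V2_def A_def by simp
  then have nV2: "\<not> V2 \<subseteq> {u, v}" using y by blast
  let ?S = "?E \<rightarrow>\<^sub>E (UNIV :: 'f set)"
  let ?N = "{\<alpha> \<in> ?S. graph_polynomial G \<alpha> \<noteq> 0}" and ?Z = "{\<alpha> \<in> ?S. graph_polynomial G \<alpha> = 0}"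
  have "int CARD('f) ^ 3 dvd int (card ?N)"
    using glued_nonzero_count[OF E1 E2 disj V12 \<open>u \<noteq> v\<close> nV1 nV2, where 'f = 'f]
    unfolding V E_Un graph_polynomial_eq_compl_poly spanning_trees_eq_forests[OF G u] .
  moreover have "int (card ?Z) = int CARD('f) ^ card ?E - int (card ?N)"
  proof -
    have "card ?S = CARD('f) ^ card ?E" using finE by (simp add: card_PiE)
    moreover have "card (?Z \<union> ?N) = card ?Z + card ?N"
      using finite_points[OF finE, where 'f = 'f] by (intro card_Un_disjoint) auto
    moreover have "?Z \<union> ?N = ?S" by blast
    ultimately have "CARD('f) ^ card ?E = card ?Z + card ?N" by simp
    then show ?thesis 
      by (simp add: of_nat_power[symmetric] del: of_nat_power)
  qed
  moreover have "int CARD('f) ^ 3 dvd int CARD('f) ^ card ?E"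
    using assms(2) by (rule le_imp_power_dvd)
  ultimately show ?thesis unfolding point_count_def by simp
qed

theorem proposition31:
  fixes G :: "('v, 'e) multigraph" and q :: nat
  assumes "finite_multigraph G"
    and "connected_graph G"
    and "2 * loop_number G \<le> int (card (edges G))"
    and "card (edges G) \<ge> 5"
    and "two_vertex_reducible G"
    and "primepow q"
    and "CARD('f::{field,finite}) = q"
  shows "[c2 TYPE('f) G = 0] (mod q)"
proof -
  have "int CARD('f) ^ 3 dvd int (point_count TYPE('f) G)"
    using assms by (intro cube_dvd_point_count) auto
  then have "CARD('f) ^ 3 dvd point_count TYPE('f) G"
    by (simp add: of_nat_power[symmetric] del: of_nat_power)
  then have "c2 TYPE('f) G = 0"
    by (intro c2_eqI) (simp_all add: cong_def mod_eq_0_iff_dvd)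
  then show ?thesis by simp
qed

end
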